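(* Let $\Gamma$ be a non-trivial divisible subgroup of $\mathbb R$, let $N$ be a free abelian group of rank $n$ with dual $M$, let $\Lambda$ be a lattice in $N_{\mathbb R}$, let $b$ be a positive definite inner product on $N_{\mathbb R}$ and $(z_\lambda)_{\lambda\in\Lambda}$ a $\Lambda$-cocycle on $N_{\mathbb R}$ satisfying: $b(\lambda,x)\in\mathbb Z$ for all $x\in N$, $\lambda\in\Lambda$; $z_{\lambda+\nu}(\omega)=z_\lambda(\omega+\nu)+z_\nu(\omega)$; $z_\lambda(\omega)=z_\lambda(0)+b(\lambda,\omega)$; and $z_\lambda(0)\in\Gamma$, for all $\lambda,\nu\in\Lambda$, $\omega\in N_{\mathbb R}$. Let $\Sigma$ be a finite set of polytopes in $N_{\mathbb R}$ which includes with a polytope also all its faces. Let $f\colon N_{\mathbb R}\to\mathbb R$ be a convex function satisfying the cocycle rule $f(\omega+\lambda)=f(\omega)+z_\lambda(\omega)$ for all $\omega\in N_{\mathbb R}$, $\lambda\in\Lambda$. Then $f$ is the uniform limit of functions $f_k$ satisfying the same cocycle rule such that every $f_k$ is a piecewise $(\mathbb Q,\Gamma)$-linear strictly convex function with respect to a locally finite $(\mathbb Z,\Gamma)$-polytopal decomposition $\mathcal C_k$ of $N_{\mathbb R}$ which is $\Lambda$-periodic and $\Sigma$-transversal.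
   Context: $N_{\mathbb R}=N\otimes\mathbb R$, $M=\mathrm{Hom}(N,\mathbb Z)$. For a subring $R\subset\mathbb R$ with $\Gamma$ an $R$-module, a function $u+c$ on $N_{\mathbb R}$ is $(R,\Gamma)$-affine if $u\in M_R$ (the slope) and $c\in\Gamma$. A polyhedron is a finite intersection of half-spaces $\{g\le0\}$, $g$ affine; it is an $(R,\Gamma)$-polyhedron if the $g$ can be chosen $(R,\Gamma)$-affine; a polytope is a bounded polyhedron. A polyhedral complex is a locally finite set of polyhedra, closed under faces, in which any two members intersect in a common (possibly empty) face. A locally finite polytopal decomposition of $N_{\mathbb R}$ is a polyhedral complex of polytopes with support $N_{\mathbb R}$; it is a $(\mathbb Z,\Gamma)$-polytopal decomposition if all members are $(\mathbb Z,\Gamma)$-polytopes. A function is piecewise $(\mathbb Q,\Gamma)$-linear if there is a $(\mathbb Q,\Gamma)$-polyhedral complex with support $N_{\mathbb R}$ on each member of which it is $(\mathbb Q,\Gamma)$-affine. A piecewise linear function $f$ is strictly convex with respect to a locally finite polytopal decomposition $\mathcal C$ if $f$ is convex, affine on each $\sigma\in\mathcal C$, and the slopes of $f$ on different maximal faces of $\mathcal C$ are different. $\mathcal C$ is $\Lambda$-periodic if for all $\Delta\in\mathcal C$ and $\lambda\in\Lambda\setminus\{0\}$, $\Delta+\lambda$ is a member of $\mathcal C$ disjoint from $\Delta$. $\mathcal C$ is $\Sigma$-transversal if for all $\sigma\in\Sigma$ and $\Delta\in\mathcal C$ with $\sigma\cap\Delta\ne\emptyset$ one has $\dim(\sigma\cap\Delta)=\dim(\Delta)+\dim(\sigma)-n$.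 *)

theory Defs
  imports "HOL-Analysis.Analysis"
begin

text \<open>
  The real vector space \<open>N\<^sub>\<real> = N \<otimes> \<real>\<close> is a type \<open>'a\<close> of class euclidean_space; its built-in inner
  product is auxiliary (it only supplies the topology). A free abelian group \<open>N\<close> of rank
  \<open>n = DIM('a)\<close> together with the identification of \<open>N \<otimes> \<real>\<close> with \<open>'a\<close> is the same thing as the
  \<open>\<int>\<close>-span of a vector space basis of \<open>'a\<close>.
\<close>

definition full_lattice :: "'a::real_vector set \<Rightarrow> bool" where
  "full_lattice L \<longleftrightarrow>
     (\<exists>B. finite B \<and> independent B \<and> span B = UNIV \<and>
          L = range (\<lambda>k :: 'a \<Rightarrow> int. \<Sum>x\<in>B. of_int (k x) *\<^sub>R x))"

definition divisible_subgroup :: "real set \<Rightarrow> bool" where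
  "divisible_subgroup \<Gamma> \<longleftrightarrow>
     0 \<in> \<Gamma> \<and> (\<forall>x\<in>\<Gamma>. \<forall>y\<in>\<Gamma>. x + y \<in> \<Gamma>) \<and> (\<forall>x\<in>\<Gamma>. - x \<in> \<Gamma>) \<and>
     (\<forall>x\<in>\<Gamma>. \<forall>m::nat. m > 0 \<longrightarrow> (\<exists>y\<in>\<Gamma>. real m * y = x))"

definition pos_def_inner_product :: "('a::real_vector \<Rightarrow> 'a \<Rightarrow> real) \<Rightarrow> bool" where
  "pos_def_inner_product b \<longleftrightarrow>
     bilinear b \<and> (\<forall>x y. b x y = b y x) \<and> (\<forall>x. x \<noteq> 0 \<longrightarrow> b x x > 0)"

text \<open>
  \<open>M\<^sub>R = Hom(N, \<int>) \<otimes> R = Hom(N, R)\<close>, every homomorphism being extended \<open>\<real>\<close>-linearly to \<open>N\<^sub>\<real>\<close>.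
\<close>

definition dual_module :: "'a::real_vector set \<Rightarrow> real set \<Rightarrow> ('a \<Rightarrow> real) set" where
  "dual_module N R = {u. linear u \<and> (\<forall>x\<in>N. u x \<in> R)}"

definition affine_functions :: "'a::real_vector set \<Rightarrow> real set \<Rightarrow> real set \<Rightarrow> ('a \<Rightarrow> real) set" where
  "affine_functions N R \<Gamma> = {\<lambda>x. u x + c | u c. u \<in> dual_module N R \<and> c \<in> \<Gamma>}"

definition RG_polyhedron :: "'a::real_vector set \<Rightarrow> real set \<Rightarrow> real set \<Rightarrow> 'a set \<Rightarrow> bool" where
  "RG_polyhedron N R \<Gamma> P \<longleftrightarrow>
     (\<exists>G. finite G \<and> G \<subseteq> affine_functions N R \<Gamma> \<and> P = {x. \<forall>g\<in>G. g x \<le> 0})"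

definition RG_polytope ::
  "'a::euclidean_space set \<Rightarrow> real set \<Rightarrow> real set \<Rightarrow> 'a set \<Rightarrow> bool" where
  "RG_polytope N R \<Gamma> P \<longleftrightarrow> RG_polyhedron N R \<Gamma> P \<and> bounded P"

text \<open>
  The empty set is a face of every polyhedron in the sense of \<open>face_of\<close>, so it belongs to every
  nonempty complex.
\<close>

definition polyhedral_complex :: "'a::euclidean_space set set \<Rightarrow> bool" where
  "polyhedral_complex \<C> \<longleftrightarrow>
     locally_finite_in euclidean \<C> \<and>
     (\<forall>P\<in>\<C>. polyhedron P) \<and>
     (\<forall>P\<in>\<C>. \<forall>F. F face_of P \<longrightarrow> F \<in> \<C>) \<and>
     (\<forall>P\<in>\<C>. \<forall>Q\<in>\<C>. P \<inter> Q face_of P \<and> P \<inter> Q face_of Q)"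

definition RG_polytopal_decomposition ::
  "'a::euclidean_space set \<Rightarrow> real set \<Rightarrow> real set \<Rightarrow> 'a set set \<Rightarrow> bool" where
  "RG_polytopal_decomposition N R \<Gamma> \<C> \<longleftrightarrow>
     polyhedral_complex \<C> \<and> \<Union>\<C> = UNIV \<and> (\<forall>P\<in>\<C>. RG_polytope N R \<Gamma> P)"

definition piecewise_RG_linear ::
  "'a::euclidean_space set \<Rightarrow> real set \<Rightarrow> real set \<Rightarrow> ('a \<Rightarrow> real) \<Rightarrow> bool" where
  "piecewise_RG_linear N R \<Gamma> f \<longleftrightarrow>
     (\<exists>\<C>. polyhedral_complex \<C> \<and> \<Union>\<C> = UNIV \<and>
          (\<forall>P\<in>\<C>. RG_polyhedron N R \<Gamma> P) \<and>
          (\<forall>P\<in>\<C>. \<exists>g\<in>affine_functions N R \<Gamma>. \<forall>x\<in>P. f x = g x))"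

definition maximal_faces :: "'a set set \<Rightarrow> 'a set set" where
  "maximal_faces \<C> = {P\<in>\<C>. \<forall>Q\<in>\<C>. P \<subseteq> Q \<longrightarrow> Q = P}"

definition has_slope_on :: "('a::real_vector \<Rightarrow> real) \<Rightarrow> ('a \<Rightarrow> real) \<Rightarrow> 'a set \<Rightarrow> bool" where
  "has_slope_on f u P \<longleftrightarrow> linear u \<and> (\<exists>c. \<forall>x\<in>P. f x = u x + c)"

text \<open>
  The maximal faces of a locally finite polytopal decomposition are full-dimensional, so the slope
  of \<open>f\<close> on each of them is unique.
\<close>

definition strictly_convex_wrt :: "'a::euclidean_space set set \<Rightarrow> ('a \<Rightarrow> real) \<Rightarrow> bool" where
  "strictly_convex_wrt \<C> f \<longleftrightarrow>
     convex_on UNIV f \<and>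
     (\<forall>P\<in>\<C>. \<exists>u. has_slope_on f u P) \<and>
     (\<forall>P\<in>maximal_faces \<C>. \<forall>Q\<in>maximal_faces \<C>. \<forall>u v.
        P \<noteq> Q \<and> has_slope_on f u P \<and> has_slope_on f v Q \<longrightarrow> u \<noteq> v)"

definition periodic_complex :: "'a::real_vector set \<Rightarrow> 'a set set \<Rightarrow> bool" where
  "periodic_complex \<Lambda> \<C> \<longleftrightarrow>
     (\<forall>P\<in>\<C>. \<forall>l\<in>\<Lambda> - {0}. (+) l ` P \<in> \<C> \<and> (+) l ` P \<inter> P = {})"

definition transversal_to :: "'a::euclidean_space set set \<Rightarrow> 'a set set \<Rightarrow> bool" where
  "transversal_to \<Sigma> \<C> \<longleftrightarrow>
     (\<forall>\<sigma>\<in>\<Sigma>. \<forall>P\<in>\<C>. \<sigma> \<inter> P \<noteq> {} \<longrightarrow>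
        aff_dim (\<sigma> \<inter> P) = aff_dim P + aff_dim \<sigma> - int DIM('a))"

definition cocycle_rule ::
  "'a::real_vector set \<Rightarrow> ('a \<Rightarrow> 'a \<Rightarrow> real) \<Rightarrow> ('a \<Rightarrow> real) \<Rightarrow> bool" where
  "cocycle_rule \<Lambda> z f \<longleftrightarrow> (\<forall>l\<in>\<Lambda>. \<forall>w. f (w + l) = f w + z l w)"

end

theory Submission
  imports Defs
begin

text \<open>
  For \<open>\<mu>\<close> in a refinement \<open>\<Lambda> / m\<close> of the lattice, let \<open>f\<^sub>\<mu>\<close> be the largest affine function with
  slope \<open>b \<mu>\<close> below \<open>f\<close>. The maximum of all \<open>f\<^sub>\<mu>\<close> tends to \<open>f\<close> as \<open>m\<close> grows, and it satisfies the
  cocycle rule because adding \<open>l \<in> \<Lambda>\<close> to both the slope parameter and the argument permutes the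
  \<open>f\<^sub>\<mu>\<close> up to the cocycle. Its domains of affinity are the cells of a decomposition with respect to which it is
  strictly convex. Four things have to be arranged.

  \<^item> \<^emph>\<open>Rationality.\<close> The slopes are rational since \<open>b\<close> is integral on \<open>\<Lambda> \<times> N\<close>. The cocycle relation
    forces \<open>b\<close> to take values in \<open>\<Gamma>\<close> on \<open>\<Lambda>\<close>, and hence on all rational points, as \<open>\<Gamma>\<close> is divisible.
    So it is consistent with the action of \<open>\<Lambda>\<close> to move the constants into \<open>\<Gamma>\<close>, which is dense in
    \<open>\<real>\<close>.

  \<^item> \<^emph>\<open>Bounded cells, disjoint from their translates.\<close> There is a quadratic function \<open>q\<close> with Hessian
    \<open>b\<close> that satisfies the cocycle rule, and \<open>f - q\<close> is periodic, so bounded. Replacing \<open>f\<close> by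
    \<open>(1 - \<epsilon>) f + \<epsilon> q\<close> changes it by \<open>O(\<epsilon>)\<close> and makes it strongly convex
    (\<open>strongly_convex_approximation\<close>). A function that is affine on a cell and uniformly close to a
    strongly convex one forces the cell to be small (\<open>approximating_family\<close>).

  \<^item> \<^emph>\<open>The complex.\<close> Near a point only finitely many of the affine functions are active, that is,
    attain the maximum. A face of a cell is determined by the set of functions active at any of its
    relative interior points (\<open>face_of_cell_rel_interior\<close>), which yields the axioms of a polyhedral
    complex.

  \<^item> \<^emph>\<open>Transversality.\<close> Translating the complex by \<open>t\<close>, and adding \<open>b t\<close> to the translated function
    to restore the cocycle rule, preserves all of the above when \<open>t\<close> is rational (\<open>translate\<close>). A
    pair of faces in bad position meets after translation only if \<open>t\<close> lies in a certain hyperplane,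
    and finitely many pairs matter, so a small rational \<open>t\<close> works
    (\<open>generic_translate_transversal\<close>). That it suffices to exclude such pairs follows by separating
    two relative interiors (\<open>aff_dim_Int_transversal\<close>).
\<close>

section \<open>Convexity\<close>

text \<open>
  A supporting hyperplane of the epigraph at a boundary point cannot be vertical, because the
  function is finite everywhere; hence it is the graph of an affine minorant.
\<close>

lemma convex_on_UNIV_subgradient:
  fixes f :: "'a::euclidean_space \<Rightarrow> real"
  assumes f: "convex_on UNIV f"
  obtains v where "\<And>y. f x + v \<bullet> (y - x) \<le> f y"
proof -
  have "convex ({x} \<times> {..<f x})" "convex (epigraph UNIV f)"
    using f by (auto simp: convex_epigraph intro: convex_Times)
  moreover have "({x} \<times> {..<f x}) \<inter> epigraph UNIV f = {}"
    by (auto simp: epigraph_def)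
  moreover have "{x} \<times> {..<f x} \<noteq> {}" "epigraph UNIV f \<noteq> {}"
    by (auto simp: epigraph_def)
  ultimately obtain a \<beta> where a: "a \<noteq> 0" "\<forall>p\<in>{x} \<times> {..<f x}. a \<bullet> p \<le> \<beta>"
      "\<forall>p\<in>epigraph UNIV f. a \<bullet> p \<ge> \<beta>"
    using separating_hyperplane_sets[of "{x} \<times> {..<f x}" "epigraph UNIV f"] by blast
  obtain n r where [simp]: "a = (n, r)" by (cases a)
  have sep: "n \<bullet> x + r * s \<le> n \<bullet> y + r * f y" if "s < f x" for s y
    using a(2)[rule_format, of "(x, s)"] a(3)[rule_format, of "(y, f y)"] that
    by (simp add: epigraph_def)
  have "r \<ge> 0"
    using sep[of "f x - 1" x] by (simp add: algebra_simps)
  moreover have "r \<noteq> 0"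
  proof
    assume "r = 0"
    then have "n \<noteq> 0" using a by (simp add: zero_prod_def)
    moreover have "n \<bullet> x \<le> n \<bullet> (x - n)"
      using sep[of "f x - 1" "x - n"] \<open>r = 0\<close> by simp
    ultimately show False
      using inner_gt_zero_iff[of n] by (force simp: inner_diff_right)
  qed
  ultimately have "r > 0" by simp
  have "f x + (- n /\<^sub>R r) \<bullet> (y - x) \<le> f y" for y
  proof (rule field_le_epsilon)
    fix e :: real assume "e > 0"
    have "n \<bullet> x + r * (f x - e) \<le> n \<bullet> y + r * f y"
      using sep[of "f x - e" y] \<open>e > 0\<close> by simp
    then show "f x + (- n /\<^sub>R r) \<bullet> (y - x) \<le> f y + e"
      using \<open>r > 0\<close> by (simp add: field_simps inner_diff_right)
  qed
  then show ?thesis by (rule that)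
qed

text \<open>
  Disjoint relative interiors would be separated by a functional \<open>a \<noteq> 0\<close>. Its level set through
  \<open>x\<close> supports \<open>S\<close> and \<open>T\<close> and cuts out of each of them a face through \<open>x\<close> on which \<open>a\<close> is
  constant, which is what the hypothesis excludes. Once the relative interiors meet,
  \<open>S \<inter> T\<close> is as large as the intersection of the affine hulls. These span the whole space, since
  otherwise a functional would be constant on \<open>S\<close> and on \<open>T\<close> themselves.
\<close>

lemma aff_dim_Int_transversal:
  fixes S T :: "'a::euclidean_space set"
  assumes "convex S" "convex T" and x: "x \<in> S" "x \<in> T"
    and transversal: "\<And>F G a. F face_of S \<Longrightarrow> G face_of T \<Longrightarrow> x \<in> F \<Longrightarrow> x \<in> G \<Longrightarrow>
      (\<And>y. y \<in> F \<Longrightarrow> a \<bullet> y = a \<bullet> x) \<Longrightarrow> (\<And>y. y \<in> G \<Longrightarrow> a \<bullet> y = a \<bullet> x) \<Longrightarrow> a = 0"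
  shows "aff_dim (S \<inter> T) = aff_dim S + aff_dim T - int DIM('a)"
proof -
  have "rel_interior S \<inter> rel_interior T \<noteq> {}"
  proof
    assume "rel_interior S \<inter> rel_interior T = {}"
    moreover have "rel_interior S \<noteq> {}" "rel_interior T \<noteq> {}"
      using assms(1,2) x rel_interior_eq_empty by auto
    ultimately obtain a \<beta> where a: "a \<noteq> 0" "\<forall>y\<in>rel_interior S. a \<bullet> y \<le> \<beta>"
        "\<forall>y\<in>rel_interior T. a \<bullet> y \<ge> \<beta>"
      using separating_hyperplane_sets[of "rel_interior S" "rel_interior T"]
        convex_rel_interior assms(1,2) by blast
    have "closure (rel_interior S) \<subseteq> {y. a \<bullet> y \<le> \<beta>}"
      using a by (intro closure_minimal) (auto simp: closed_halfspace_le)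
    then have S: "S \<subseteq> {y. a \<bullet> y \<le> \<beta>}"
      using convex_closure_rel_interior[OF assms(1)] closure_subset by blast
    have "closure (rel_interior T) \<subseteq> {y. a \<bullet> y \<ge> \<beta>}"
      using a by (intro closure_minimal) (auto simp: closed_halfspace_ge)
    then have T: "T \<subseteq> {y. a \<bullet> y \<ge> \<beta>}"
      using convex_closure_rel_interior[OF assms(2)] closure_subset by blast
    have "a \<bullet> x = \<beta>" using S T x by force
    moreover have "S \<inter> {y. a \<bullet> y = \<beta>} face_of S" "T \<inter> {y. a \<bullet> y = \<beta>} face_of T"
      using S T by (auto intro!: face_of_Int_supporting_hyperplane_le[OF assms(1)]
          face_of_Int_supporting_hyperplane_ge[OF assms(2)])
    ultimately have "a = 0"
      by (intro transversal[of "S \<inter> {y. a \<bullet> y = \<beta>}" "T \<inter> {y. a \<bullet> y = \<beta>}" a])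
        (use x in simp_all)
    with a show False by simp
  qed
  then obtain w where w: "w \<in> rel_interior S" "w \<in> rel_interior T" by auto
  let ?A = "affine hull S" and ?B = "affine hull T"
  obtain d e where "d > 0" "ball w d \<inter> ?A \<subseteq> S" and "e > 0" "ball w e \<inter> ?B \<subseteq> T"
    using w by (auto simp: mem_rel_interior_ball)
  then have sub: "?A \<inter> ?B \<inter> ball w (min d e) \<subseteq> S \<inter> T"
    by auto
  have w': "w \<in> ?A \<inter> ?B \<inter> ball w (min d e)"
    using w rel_interior_subset hull_subset[of S affine] hull_subset[of T affine]
      \<open>d > 0\<close> \<open>e > 0\<close> by auto
  have aff: "affine (?A \<inter> ?B)" by (simp add: affine_Int)
  have "aff_dim (?A \<inter> ?B) = aff_dim (?A \<inter> ?B \<inter> ball w (min d e))"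
    using affine_hull_affine_Int_open[OF aff, of "ball w (min d e)"] w'
    by (metis aff_dim_affine_hull empty_iff open_ball)
  also have "\<dots> \<le> aff_dim (S \<inter> T)"
    using sub by (rule aff_dim_subset)
  finally have 1: "aff_dim (S \<inter> T) = aff_dim (?A \<inter> ?B)"
    using aff_dim_subset[of "S \<inter> T" "?A \<inter> ?B"] hull_subset[of S affine] hull_subset[of T affine]
    by (meson Int_mono order_antisym)
  have "\<not> aff_dim {u + v |u v. u \<in> ?A \<and> v \<in> ?B} < DIM('a)"
  proof
    assume "aff_dim {u + v |u v. u \<in> ?A \<and> v \<in> ?B} < DIM('a)"
    then obtain a \<beta> where a: "a \<noteq> 0" "{u + v |u v. u \<in> ?A \<and> v \<in> ?B} \<subseteq> {y. a \<bullet> y = \<beta>}"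
      by (rule aff_lowdim_subset_hyperplane)
    have ab: "a \<bullet> u + a \<bullet> v = \<beta>" if "u \<in> S" "v \<in> T" for u v
    proof -
      have "u + v \<in> {u + v |u v. u \<in> ?A \<and> v \<in> ?B}"
        using that hull_subset[of S affine] hull_subset[of T affine] by blast
      then have "u + v \<in> {y. a \<bullet> y = \<beta>}" using a(2) by (rule rev_subsetD)
      then show ?thesis by (simp add: inner_add_right)
    qed
    have "a = 0"
    proof (rule transversal[of S T])
      show "a \<bullet> y = a \<bullet> x" if "y \<in> S" for y
        using ab[OF that x(2)] ab[OF x] by simp
      show "a \<bullet> y = a \<bullet> x" if "y \<in> T" for y
        using ab[OF x(1) that] ab[OF x] by simp
    qed (use assms(1,2) x in \<open>auto intro: face_of_refl\<close>)
    with a show False by simp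
  qed
  then have "aff_dim {u + v |u v. u \<in> ?A \<and> v \<in> ?B} = DIM('a)"
    using aff_dim_le_DIM[of "{u + v |u v. u \<in> ?A \<and> v \<in> ?B}"] by linarith
  moreover have "aff_dim {u + v |u v. u \<in> ?A \<and> v \<in> ?B} = aff_dim ?A + aff_dim ?B - aff_dim (?A \<inter> ?B)"
    using w' by (intro aff_dim_sums_Int) auto
  ultimately show ?thesis
    using 1 by simp
qed

text \<open>
  A finite union of hyperplanes is closed and has measure zero, so its complement in a ball is a
  nonempty open set, which \<open>D\<close> has to meet.
\<close>

lemma dense_avoids_hyperplanes:
  fixes D :: "'a::euclidean_space set"
  assumes dense: "\<And>x r. r > 0 \<Longrightarrow> \<exists>t\<in>D. norm (x - t) < r"
    and H: "finite H" "\<And>a \<beta>. (a, \<beta>) \<in> H \<Longrightarrow> a \<noteq> 0" and "e > 0"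
  obtains t where "t \<in> D" "norm t < e" "\<And>a \<beta>. (a, \<beta>) \<in> H \<Longrightarrow> a \<bullet> t \<noteq> \<beta>"
proof -
  define U where "U = (\<Union>(a, \<beta>)\<in>H. {x. a \<bullet> x = \<beta>})"
  have "closed U"
    unfolding U_def using H by (auto intro!: closed_UN simp: closed_hyperplane)
  have "negligible U"
    unfolding U_def using H by (auto intro!: negligible_Union negligible_hyperplane)
  then have "\<not> ball 0 e \<subseteq> U"
    using open_not_negligible[of "ball 0 e"] negligible_subset \<open>e > 0\<close>
    by (metis centre_in_ball empty_iff open_ball)
  then obtain x where x: "x \<in> ball 0 e - U" by blast
  have "open (ball 0 e - U)" using \<open>closed U\<close> by auto
  then obtain r where "r > 0" "ball x r \<subseteq> ball 0 e - U"
    using x openE by blast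
  moreover obtain t where "t \<in> D" "norm (x - t) < r" using dense \<open>r > 0\<close> by blast
  ultimately have "t \<in> ball 0 e - U" by (auto simp: dist_norm subset_iff)
  then show ?thesis using \<open>t \<in> D\<close> by (intro that[of t]) (auto simp: U_def)
qed

section \<open>The inner product\<close>

locale pos_def_form =
  fixes b :: "'a::euclidean_space \<Rightarrow> 'a \<Rightarrow> real"
  assumes pos_def: "pos_def_inner_product b"
begin

lemma bil: "bilinear b"
  using pos_def by (simp add: pos_def_inner_product_def)

lemma b_sym: "b x y = b y x"
  using pos_def by (simp add: pos_def_inner_product_def)

lemma b_pos: "x \<noteq> 0 \<Longrightarrow> b x x > 0"
  using pos_def by (simp add: pos_def_inner_product_def)

lemmas b_simps = bilinear_ladd[OF bil] bilinear_radd[OF bil] bilinear_lsub[OF bil]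
  bilinear_rsub[OF bil] bilinear_lmul[OF bil] bilinear_rmul[OF bil] bilinear_lneg[OF bil]
  bilinear_rneg[OF bil] bilinear_lzero[OF bil] bilinear_rzero[OF bil]

lemma b_nonneg: "b x x \<ge> 0"
  using b_pos[of x] by (cases "x = 0") (auto simp: b_simps)

lemma linear_b: "linear (b u)"
  using bil by (simp add: bilinear_def)

lemma b_eqI: "(\<And>x. b u x = b v x) \<Longrightarrow> u = v"
  using b_pos[of "u - v"] by (force simp: b_simps)

lemma b_upper:
  obtains K where "K > 0" "\<And>x y. \<bar>b x y\<bar> \<le> K * norm x * norm y"
  using bilinear_bounded_pos[OF bil] by auto

lemma b_lower:
  obtains \<kappa> where "\<kappa> > 0" "\<And>x. \<kappa> * (norm x)\<^sup>2 \<le> b x x"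
proof -
  have bb: "bounded_bilinear b"
    using bil by (simp add: bilinear_conv_bounded_bilinear)
  have "continuous_on (sphere 0 1) (\<lambda>x. b x x)"
    by (intro bounded_bilinear.continuous_on[OF bb] continuous_intros)
  moreover have "sphere (0::'a) 1 \<noteq> {}" by simp
  ultimately obtain u where u: "norm u = 1" "\<And>x. norm x = 1 \<Longrightarrow> b u u \<le> b x x"
    using continuous_attains_inf[OF compact_sphere, of 0 1 "\<lambda>x. b x x"] by force
  have "b u u * (norm x)\<^sup>2 \<le> b x x" for x
  proof (cases "x = 0")
    case False
    then have "b u u \<le> b (x /\<^sub>R norm x) (x /\<^sub>R norm x)"
      by (intro u) simp
    also have "\<dots> = b x x / (norm x)\<^sup>2"
      by (simp add: b_simps power2_eq_square divide_inverse)
    finally show ?thesis using False by (simp add: field_simps)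
  qed (simp add: b_simps)
  moreover have "b u u > 0" using u(1) b_pos[of u] by force
  ultimately show ?thesis using that by blast
qed

lemma b_eq_inner: "b v x = (\<Sum>e\<in>Basis. b v e *\<^sub>R e) \<bullet> x"
proof -
  have "b v x = b v (\<Sum>e\<in>Basis. (x \<bullet> e) *\<^sub>R e)" by (simp add: euclidean_representation)
  also have "\<dots> = (\<Sum>e\<in>Basis. (x \<bullet> e) * b v e)"
    unfolding linear_sum[OF linear_b] by (simp only: bilinear_rmul[OF bil] real_scaleR_def)
  finally show ?thesis by (simp add: inner_commute[of _ x] inner_sum_right mult.commute)
qed

text \<open>The map \<open>v \<mapsto> b v\<close> into the dual is injective, hence bijective by equality of dimensions.\<close>

lemma b_represents:
  obtains v where "\<And>x. b v x = w \<bullet> x"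
proof -
  define T where "T v = (\<Sum>e\<in>Basis. b v e *\<^sub>R e)" for v
  have "linear T"
    unfolding T_def
    by (rule linearI) (simp_all add: b_simps sum.distrib scaleR_sum_right algebra_simps)
  moreover have "inj T"
  proof (rule injI)
    fix u v assume "T u = T v"
    then have "b u x = b v x" for x
      using b_eq_inner[of u x] b_eq_inner[of v x] by (simp add: T_def)
    then show "u = v" by (rule b_eqI)
  qed
  ultimately obtain v where "T v = w"
    using linear_injective_imp_surjective[of T] by (metis surjD)
  then have "b v x = w \<bullet> x" for x
    using b_eq_inner[of v x] by (simp add: T_def)
  then show ?thesis by (rule that)
qed

text \<open>Complete the square: \<open>b (e x - u) (e x - u) \<ge> 0\<close>.\<close>

lemma quadratic_absorbs_linear:
  assumes "e > 0"
  shows "e / 2 * b x x - b u x \<ge> - b u u / (2 * e)"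
proof -
  have "b (e *\<^sub>R x - u) (e *\<^sub>R x - u) \<ge> 0" by (rule b_nonneg)
  then have "e * e * b x x - 2 * e * b u x + b u u \<ge> 0"
    by (simp add: b_simps b_sym[of x u] algebra_simps)
  then have "(e * e * b x x - 2 * e * b u x + b u u) / (2 * e) \<ge> 0"
    using assms by simp
  also have "(e * e * b x x - 2 * e * b u x + b u u) / (2 * e) = e / 2 * b x x - b u x + b u u / (2 * e)"
    using assms by (simp add: field_simps)
  finally show ?thesis by simp
qed

end

section \<open>Lattices\<close>

lemma full_lattice_coords:
  fixes L :: "'a::real_vector set"
  assumes "full_lattice L"
  obtains B where "finite B" "independent B" "span B = UNIV"
    "\<And>x. x \<in> L \<longleftrightarrow> (\<exists>k :: 'a \<Rightarrow> int. x = (\<Sum>v\<in>B. of_int (k v) *\<^sub>R v))"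
proof -
  obtain B where "finite B" "independent B" "span B = UNIV"
    and L: "L = range (\<lambda>k :: 'a \<Rightarrow> int. \<Sum>v\<in>B. of_int (k v) *\<^sub>R v)"
    using assms unfolding full_lattice_def by blast
  then show ?thesis by (intro that[of B]) (simp_all add: L image_iff)
qed

lemma full_lattice_closed:
  fixes L :: "'a::real_vector set"
  assumes "full_lattice L"
  shows full_lattice_0: "0 \<in> L"
    and full_lattice_add: "x \<in> L \<Longrightarrow> y \<in> L \<Longrightarrow> x + y \<in> L"
    and full_lattice_scaleR_int: "x \<in> L \<Longrightarrow> of_int k *\<^sub>R x \<in> L"
    and full_lattice_neg: "x \<in> L \<Longrightarrow> - x \<in> L"
proof -
  obtain B where L: "\<And>x. x \<in> L \<longleftrightarrow> (\<exists>k :: 'a \<Rightarrow> int. x = (\<Sum>v\<in>B. of_int (k v) *\<^sub>R v))"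
    using full_lattice_coords[OF assms] by metis
  show "0 \<in> L" unfolding L by (rule exI[of _ "\<lambda>_. 0"]) simp
  show "x + y \<in> L" if "x \<in> L" "y \<in> L"
  proof -
    from that(1) obtain k :: "'a \<Rightarrow> int" where "x = (\<Sum>v\<in>B. of_int (k v) *\<^sub>R v)"
      unfolding L ..
    moreover from that(2) obtain j :: "'a \<Rightarrow> int" where "y = (\<Sum>v\<in>B. of_int (j v) *\<^sub>R v)"
      unfolding L ..
    ultimately show ?thesis
      unfolding L by (intro exI[of _ "\<lambda>v. k v + j v"]) (simp add: sum.distrib scaleR_add_left)
  qed
  show mult: "of_int k *\<^sub>R x \<in> L" if "x \<in> L" for k
  proof -
    from that obtain j :: "'a \<Rightarrow> int" where "x = (\<Sum>v\<in>B. of_int (j v) *\<^sub>R v)"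
      unfolding L ..
    then show ?thesis
      unfolding L by (intro exI[of _ "\<lambda>v. k * j v"]) (simp add: scaleR_sum_right)
  qed
  show "- x \<in> L" if "x \<in> L"
    using mult[OF that, of "-1"] by simp
qed

lemma full_lattice_basis:
  assumes "full_lattice L"
  obtains B where "finite B" "independent B" "span B = UNIV" "B \<subseteq> L"
    "\<And>x. x \<in> L \<Longrightarrow> \<exists>k :: 'a::real_vector \<Rightarrow> int. x = (\<Sum>v\<in>B. of_int (k v) *\<^sub>R v)"
proof -
  obtain B where B: "finite B" "independent B" "span B = UNIV"
    and L: "\<And>x. x \<in> L \<longleftrightarrow> (\<exists>k :: 'a \<Rightarrow> int. x = (\<Sum>v\<in>B. of_int (k v) *\<^sub>R v))"
    using full_lattice_coords[OF assms] by metis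
  have "x \<in> L" if "x \<in> B" for x
  proof -
    have "(\<Sum>y\<in>B. of_int (if y = x then 1 else 0) *\<^sub>R y) = (\<Sum>y\<in>B. if y = x then y else 0)"
      by (rule sum.cong) auto
    also have "\<dots> = x" using B that by simp
    finally show ?thesis
      unfolding L by (intro exI[of _ "\<lambda>y. if y = x then 1 else 0"]) simp
  qed
  then show ?thesis using B L by (intro that[of B]) auto
qed

text \<open>Rounding the coordinates down moves a point by at most the sum of the basis lengths.\<close>

lemma full_lattice_covering:
  fixes L :: "'a::real_normed_vector set"
  assumes "full_lattice L"
  obtains R where "R > 0" "\<And>x. \<exists>l\<in>L. norm (x - l) \<le> R"
proof -
  obtain B where B: "finite B" "span B = UNIV"
    and L: "\<And>x. x \<in> L \<longleftrightarrow> (\<exists>k :: 'a \<Rightarrow> int. x = (\<Sum>v\<in>B. of_int (k v) *\<^sub>R v))"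
    using full_lattice_coords[OF assms] by metis
  have "\<exists>l\<in>L. norm (x - l) \<le> (\<Sum>v\<in>B. norm v) + 1" for x
  proof -
    have "x \<in> span B" using B by auto
    then obtain r where x: "x = (\<Sum>v\<in>B. r v *\<^sub>R v)"
      using span_finite[OF \<open>finite B\<close>] by auto
    let ?l = "\<Sum>v\<in>B. of_int \<lfloor>r v\<rfloor> *\<^sub>R v"
    have "x - ?l = (\<Sum>v\<in>B. (r v - of_int \<lfloor>r v\<rfloor>) *\<^sub>R v)"
      by (simp add: x sum_subtractf scaleR_diff_left)
    also have "norm \<dots> \<le> (\<Sum>v\<in>B. norm v)"
    proof (rule sum_norm_le)
      fix v
      have "\<bar>r v - of_int \<lfloor>r v\<rfloor>\<bar> \<le> 1" by linarith
      then show "norm ((r v - of_int \<lfloor>r v\<rfloor>) *\<^sub>R v) \<le> norm v"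
        using mult_right_mono[of _ 1 "norm v"] by simp
    qed
    finally show ?thesis using L[of ?l] by (intro bexI[of _ ?l]) auto
  qed
  moreover have "(\<Sum>v\<in>B. norm v) + 1 > 0" using sum_nonneg[of B norm] by simp
  ultimately show ?thesis using that by blast
qed

lemma full_lattice_additive_extension:
  fixes \<phi> :: "'a::euclidean_space \<Rightarrow> real"
  assumes L: "full_lattice L" and \<phi>: "\<And>x y. x \<in> L \<Longrightarrow> y \<in> L \<Longrightarrow> \<phi> (x + y) = \<phi> x + \<phi> y"
  obtains u where "linear u" "\<And>x. x \<in> L \<Longrightarrow> u x = \<phi> x"
proof -
  obtain B where B: "finite B" "independent B" "B \<subseteq> L"
    and LB: "\<And>x. x \<in> L \<Longrightarrow> \<exists>k :: 'a \<Rightarrow> int. x = (\<Sum>v\<in>B. of_int (k v) *\<^sub>R v)"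
    using full_lattice_basis[OF L] by metis
  obtain u where u: "linear u" "\<And>x. x \<in> B \<Longrightarrow> u x = \<phi> x"
    using linear_independent_extend[OF B(2), of \<phi>] by blast
  have BL: "x \<in> L" if "x \<in> B" for x using that B by blast
  note cl = full_lattice_0[OF L] full_lattice_neg[OF L] full_lattice_scaleR_int[OF L]
  have \<phi>0: "\<phi> 0 = 0" using \<phi>[of 0 0] cl by simp
  have \<phi>n: "\<phi> (of_nat k *\<^sub>R x) = of_nat k * \<phi> x" if "x \<in> L" for k x
  proof (induction k)
    case (Suc k)
    have "\<phi> (x + of_nat k *\<^sub>R x) = \<phi> x + \<phi> (of_nat k *\<^sub>R x)"
      using cl(3)[OF that, of "int k"] that by (intro \<phi>) auto
    then show ?case using Suc by (simp add: algebra_simps)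
  qed (simp add: \<phi>0)
  have \<phi>neg: "\<phi> (- x) = - \<phi> x" if "x \<in> L" for x
    using \<phi>[of x "- x"] cl(2)[OF that] that \<phi>0 by simp
  have \<phi>z: "\<phi> (of_int k *\<^sub>R x) = of_int k * \<phi> x" if "x \<in> L" for k x
  proof (cases "k \<ge> 0")
    case True
    then show ?thesis using \<phi>n[OF that, of "nat k"] by simp
  next
    case False
    then show ?thesis
      using \<phi>n[OF cl(2)[OF that], of "nat (- k)"] \<phi>neg[OF that] by simp
  qed
  have "(\<Sum>x\<in>A. of_int (k x) *\<^sub>R x) \<in> L \<and>
      \<phi> (\<Sum>x\<in>A. of_int (k x) *\<^sub>R x) = (\<Sum>x\<in>A. of_int (k x) * \<phi> x)" if "A \<subseteq> B" for k :: "'a \<Rightarrow> int" and A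
    using finite_subset[OF that B(1)] that
  proof (induction A rule: finite_induct)
    case (insert x A)
    then show ?case
      using cl(3)[OF BL, of x "k x"] by (auto simp: \<phi> \<phi>z BL full_lattice_add[OF L])
  qed (simp add: cl \<phi>0)
  then have "u x = \<phi> x" if "x \<in> L" for x
    using LB[OF that] u by (auto simp: linear_sum[OF u(1)] linear_scale[OF u(1)])
  with u(1) show ?thesis by (rule that)
qed

text \<open>
  A form that is integral on \<open>L \<times> N\<close> sends \<open>L\<close> injectively into integer vectors, by pairing with a
  basis of \<open>N\<close>; so discreteness of \<open>L\<close> comes from that of \<open>\<int>\<close>.
\<close>

lemma (in pos_def_form) finite_lattice_bounded:
  assumes "full_lattice N" and int: "\<And>l x. l \<in> L \<Longrightarrow> x \<in> N \<Longrightarrow> b l x \<in> \<int>" and "bounded K"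
  shows "finite (L \<inter> K)"
proof -
  obtain B where B: "finite B" "span B = UNIV" and "B \<subseteq> N"
    using full_lattice_basis[OF assms(1)] by metis
  then have BN: "x \<in> N" if "x \<in> B" for x using that by blast
  obtain C where C: "C > 0" "\<And>x y. \<bar>b x y\<bar> \<le> C * norm x * norm y" using b_upper by blast
  obtain r where r: "\<And>x. x \<in> K \<Longrightarrow> norm x \<le> r" using \<open>bounded K\<close> bounded_iff by metis
  have fin: "finite (PiE B (\<lambda>x. {k::real. k \<in> \<int> \<and> \<bar>k\<bar> \<le> C * r * norm x}))"
    using B(1) by (intro finite_PiE) (auto simp: finite_abs_int_segment)
  define F where "F l = restrict (b l) B" for l
  have "F ` (L \<inter> K) \<subseteq> PiE B (\<lambda>x. {k. k \<in> \<int> \<and> \<bar>k\<bar> \<le> C * r * norm x})"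
  proof (clarsimp simp: F_def int BN)
    fix l x assume "l \<in> K"
    have "\<bar>b l x\<bar> \<le> C * norm l * norm x" by (rule C)
    also have "\<dots> \<le> C * r * norm x"
      using C r[OF \<open>l \<in> K\<close>] by (intro mult_right_mono mult_left_mono) auto
    finally show "\<bar>b l x\<bar> \<le> C * r * norm x" .
  qed
  then have "finite (F ` (L \<inter> K))" using fin by (rule finite_subset)
  moreover have "inj_on F (L \<inter> K)"
  proof (rule inj_onI)
    fix l m assume "F l = F m"
    then have "b l x = b m x" if "x \<in> B" for x
      using that unfolding F_def by (metis restrict_apply')
    then have "b l x = b m x" for x
      using linear_eq_on_span[OF linear_b linear_b, of B l m x] B(2) by auto
    then show "l = m" by (rule b_eqI)
  qed
  ultimately show ?thesis by (rule finite_imageD)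
qed

section \<open>The complex of a locally finite maximum of affine functions\<close>

text \<open>
  The affine functions are indexed by their slopes \<open>b \<mu>\<close>, so different indices mean different
  slopes; this is what makes \<open>h\<close> strictly convex with respect to its own complex. The maximum \<open>h\<close>
  is described by its properties rather than as a supremum, so that translated families are again
  instances.
\<close>

locale tropical_family = pos_def_form b
  for b :: "'a::euclidean_space \<Rightarrow> 'a \<Rightarrow> real" +
  fixes I :: "'a set" and c :: "'a \<Rightarrow> real" and h :: "'a \<Rightarrow> real"
  assumes upper: "\<mu> \<in> I \<Longrightarrow> b \<mu> x + c \<mu> \<le> h x"
    and attained: "\<exists>\<mu>\<in>I. h x = b \<mu> x + c \<mu>"
    and finite_attaining: "bounded K \<Longrightarrow> finite {\<mu>\<in>I. \<exists>x\<in>K. h x = b \<mu> x + c \<mu>}"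
    and bounded_attaining: "\<mu> \<in> I \<Longrightarrow> bounded {x. h x = b \<mu> x + c \<mu>}"
begin

definition g :: "'a \<Rightarrow> 'a \<Rightarrow> real" where
  "g \<mu> x = b \<mu> x + c \<mu>"

definition active :: "'a \<Rightarrow> 'a \<Rightarrow> bool" where
  "active \<mu> x \<longleftrightarrow> \<mu> \<in> I \<and> h x = g \<mu> x"

text \<open>
  The points where all functions in \<open>S\<close> are active, hence intersections of full cells: these include
  all faces of cells, and the empty set.
\<close>

definition cell :: "'a set \<Rightarrow> 'a set" where
  "cell S = {x. \<forall>\<mu>\<in>S. active \<mu> x}"

definition cells :: "'a set set" where
  "cells = {cell S |S. S \<noteq> {}}"

lemma cellsE:
  assumes "P \<in> cells"
  obtains S where "S \<noteq> {}" "P = cell S"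
  using assms unfolding cells_def by blast

lemma g_le: "\<mu> \<in> I \<Longrightarrow> g \<mu> x \<le> h x"
  by (simp add: g_def upper)

lemma ex_active: "\<exists>\<mu>. active \<mu> x"
  using attained by (auto simp: active_def g_def)

lemma finite_active: "bounded K \<Longrightarrow> finite {\<mu>. \<exists>x\<in>K. active \<mu> x}"
  using finite_attaining[of K] by (rule rev_finite_subset) (auto simp: active_def g_def)

lemma g_comb: "u + v = 1 \<Longrightarrow> g \<mu> (u *\<^sub>R x + v *\<^sub>R y) = u * g \<mu> x + v * g \<mu> y"
proof -
  assume "u + v = 1"
  then have "c \<mu> = u * c \<mu> + v * c \<mu>" by (metis distrib_right mult_1)
  then show ?thesis by (simp add: g_def b_simps algebra_simps)
qed

lemma convex_h: "convex_on UNIV h"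
proof (rule convex_onI)
  fix t :: real and x y :: 'a assume t: "0 < t" "t < 1"
  obtain \<mu> where "active \<mu> ((1 - t) *\<^sub>R x + t *\<^sub>R y)" using ex_active by blast
  then have "h ((1 - t) *\<^sub>R x + t *\<^sub>R y) = (1 - t) * g \<mu> x + t * g \<mu> y" and "\<mu> \<in> I"
    by (simp_all add: active_def g_comb)
  then show "h ((1 - t) *\<^sub>R x + t *\<^sub>R y) \<le> (1 - t) * h x + t * h y"
    using t g_le[of \<mu>] by (simp add: add_mono mult_left_mono)
qed auto

lemma isCont_h: "isCont h x"
  using convex_on_continuous[OF _ convex_h] by (simp add: continuous_on_eq_continuous_at)

lemma isCont_g: "isCont (g \<mu>) x"
proof -
  have "isCont (b \<mu>) x" by (rule linear_continuous_at) (simp add: linear_b linear_linear)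
  then show ?thesis unfolding g_def[abs_def] by (intro continuous_intros)
qed

text \<open>Only finitely many of the affine functions matter near \<open>x\<close>, so an inactive one stays so.\<close>

lemma eventually_active_subset: "\<forall>\<^sub>F y in nhds x. \<forall>\<mu>. active \<mu> y \<longrightarrow> active \<mu> x"
proof -
  define J where "J = {\<mu>. \<exists>y\<in>ball x 1. active \<mu> y} - {\<mu>. active \<mu> x}"
  have "finite J" unfolding J_def by (intro finite_Diff finite_active bounded_ball)
  moreover have "\<forall>\<^sub>F y in nhds x. g \<mu> y < h y" if "\<mu> \<in> J" for \<mu>
  proof -
    have "\<mu> \<in> I" "\<not> active \<mu> x" using that by (auto simp: J_def active_def)
    then have "g \<mu> x < h x" using g_le[of \<mu> x] by (auto simp: active_def)
    moreover have "((\<lambda>y. h y - g \<mu> y) \<longlongrightarrow> h x - g \<mu> x) (nhds x)"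
      using isCont_h isCont_g by (intro tendsto_diff) (simp_all add: tendsto_nhds_iff continuous_at)
    ultimately have "\<forall>\<^sub>F y in nhds x. 0 < h y - g \<mu> y" by (intro order_tendstoD) auto
    then show ?thesis by simp
  qed
  ultimately have "\<forall>\<^sub>F y in nhds x. \<forall>\<mu>\<in>J. g \<mu> y < h y" by (simp add: eventually_ball_finite)
  moreover have "\<forall>\<^sub>F y in nhds x. y \<in> ball x 1" by (intro eventually_nhds_in_open) auto
  ultimately show ?thesis
  proof eventually_elim
    case (elim y)
    then show ?case unfolding J_def active_def by fastforce
  qed
qed

text \<open>
  On a segment on which \<open>h\<close> is affine, \<open>h\<close> minus one of the affine functions is affine and
  nonnegative; if it vanishes inside, it vanishes at both ends.
\<close>

lemma active_segment:
  assumes "0 < t" "t < 1" "active s x" "active s y" and \<mu>: "active \<mu> ((1 - t) *\<^sub>R x + t *\<^sub>R y)"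
  shows "active \<mu> x \<and> active \<mu> y"
proof -
  let ?w = "(1 - t) *\<^sub>R x + t *\<^sub>R y"
  have "s \<in> I" "\<mu> \<in> I" using assms by (auto simp: active_def)
  have "(1 - t) * h x + t * h y = g s ?w" using assms by (simp add: g_comb active_def)
  also have "\<dots> \<le> g \<mu> ?w" using \<mu> g_le[OF \<open>s \<in> I\<close>, of ?w] unfolding active_def by metis
  also have "\<dots> = (1 - t) * g \<mu> x + t * g \<mu> y" by (simp add: g_comb)
  finally have "(1 - t) * (h x - g \<mu> x) + t * (h y - g \<mu> y) \<le> 0" by (simp add: algebra_simps)
  moreover have "(1 - t) * (h x - g \<mu> x) \<ge> 0" "t * (h y - g \<mu> y) \<ge> 0"
    using assms g_le[OF \<open>\<mu> \<in> I\<close>] by simp_all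
  ultimately have "(1 - t) * (h x - g \<mu> x) = 0" "t * (h y - g \<mu> y) = 0" by linarith+
  then show ?thesis using assms \<open>\<mu> \<in> I\<close> by (simp add: active_def)
qed

lemma convex_cell: "convex (cell S)"
proof (rule convexI)
  fix x y :: 'a and u v :: real assume uv: "0 \<le> u" "0 \<le> v" "u + v = 1" and xy: "x \<in> cell S" "y \<in> cell S"
  show "u *\<^sub>R x + v *\<^sub>R y \<in> cell S"
    unfolding cell_def
  proof clarify
    fix \<mu> assume "\<mu> \<in> S"
    then have \<mu>: "active \<mu> x" "active \<mu> y" using xy by (auto simp: cell_def)
    have "h (u *\<^sub>R x + v *\<^sub>R y) \<le> u * h x + v * h y"
      using convex_h uv by (auto simp: convex_on_def)
    also have "\<dots> = g \<mu> (u *\<^sub>R x + v *\<^sub>R y)" using \<mu> uv by (simp add: active_def g_comb)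
    finally show "active \<mu> (u *\<^sub>R x + v *\<^sub>R y)"
      using \<mu> g_le[of \<mu>] by (force simp: active_def intro: antisym)
  qed
qed

lemma cell_face_of:
  assumes "S \<noteq> {}" "S \<subseteq> T"
  shows "cell T face_of cell S"
  unfolding face_of_def
proof (intro conjI ballI impI)
  show "cell T \<subseteq> cell S" using assms by (auto simp: cell_def)
  fix x y w assume "x \<in> cell S" "y \<in> cell S" "w \<in> cell T" "w \<in> open_segment x y"
  moreover from \<open>w \<in> open_segment x y\<close> obtain t where "0 < t" "t < 1" "w = (1 - t) *\<^sub>R x + t *\<^sub>R y"
    by (auto simp: in_segment)
  moreover obtain s where "s \<in> S" using assms by blast
  ultimately have "active \<mu> x \<and> active \<mu> y" if "\<mu> \<in> T" for \<mu>
    using that by (intro active_segment[of t s]) (auto simp: cell_def)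
  then show "x \<in> cell T" "y \<in> cell T" by (auto simp: cell_def)
qed (rule convex_cell)

text \<open>
  The set of functions active at a relative interior point of a face determines the face: prolonging
  a segment inside the face beyond \<open>x\<close> shows that these functions are active on the whole face, and
  prolonging a segment inside their cell beyond \<open>x\<close> stays inside the cell for a while.
\<close>

lemma face_of_cell_rel_interior:
  assumes "S \<noteq> {}" and F: "F face_of cell S" and x: "x \<in> rel_interior F"
  shows "F = cell {\<mu>. active \<mu> x}"
proof
  have "F \<subseteq> cell S" "convex F" using F face_of_imp_subset face_of_imp_convex by auto
  have "x \<in> F" using x rel_interior_subset by blast
  obtain s where "s \<in> S" using assms by blast
  show "F \<subseteq> cell {\<mu>. active \<mu> x}"
  proof
    fix y assume "y \<in> F"
    then obtain e where e: "e > 1" "(1 - e) *\<^sub>R y + e *\<^sub>R x \<in> F"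
      using x convex_rel_interior_iff[OF \<open>convex F\<close>] \<open>x \<in> F\<close> by blast
    let ?w = "(1 - e) *\<^sub>R y + e *\<^sub>R x"
    have "(1 / e) *\<^sub>R ?w = (1 / e - 1) *\<^sub>R y + x"
      using e by (simp add: scaleR_add_right diff_divide_distrib)
    then have w: "(1 - 1 / e) *\<^sub>R y + (1 / e) *\<^sub>R ?w = x" by (simp flip: scaleR_add_left)
    have "active s y" "active s ?w"
      using \<open>F \<subseteq> cell S\<close> \<open>s \<in> S\<close> \<open>y \<in> F\<close> e by (auto simp: cell_def)
    then have "active \<mu> y" if "active \<mu> x" for \<mu>
      using active_segment[of "1 / e" s y ?w \<mu>] that e unfolding w by simp
    then show "y \<in> cell {\<mu>. active \<mu> x}" by (simp add: cell_def)
  qed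
  show "cell {\<mu>. active \<mu> x} \<subseteq> F"
  proof
    fix y assume y: "y \<in> cell {\<mu>. active \<mu> x}"
    \<comment> \<open>The prolongation of the segment from \<open>y\<close> to \<open>x\<close> by the proportion \<open>t\<close>.\<close>
    define w where "w t = (1 + t) *\<^sub>R x - t *\<^sub>R y" for t :: real
    have "isCont w 0" unfolding w_def[abs_def] by (intro continuous_intros)
    then have "(w \<longlongrightarrow> x) (at_right 0)" by (simp add: w_def isCont_def filterlim_at_split)
    then have "\<forall>\<^sub>F t in at_right 0. \<forall>\<mu>. active \<mu> (w t) \<longrightarrow> active \<mu> x"
      by (rule eventually_compose_filterlim[OF eventually_active_subset])
    moreover have "\<forall>\<^sub>F t :: real in at_right 0. t > 0" by (simp add: eventually_at_right_less)
    ultimately have "\<forall>\<^sub>F t in at_right 0. (\<forall>\<mu>. active \<mu> (w t) \<longrightarrow> active \<mu> x) \<and> t > 0"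
      by (rule eventually_conj)
    then obtain t where t: "t > 0" and near: "\<And>\<mu>. active \<mu> (w t) \<Longrightarrow> active \<mu> x"
      using eventually_happens'[OF trivial_limit_at_right_real] by blast
    have gw: "g \<mu> (w t) = (1 + t) * h x - t * h y" if "active \<mu> x" for \<mu>
    proof -
      have "active \<mu> y" using y that by (simp add: cell_def)
      then show ?thesis using that g_comb[of "1 + t" "- t" \<mu> x y] by (simp add: w_def active_def)
    qed
    obtain \<nu> where "active \<nu> (w t)" using ex_active by blast
    then have "h (w t) = (1 + t) * h x - t * h y"
      using gw[OF near] unfolding active_def by simp
    then have "active \<mu> (w t)" if "active \<mu> x" for \<mu>
      using gw[OF that] that unfolding active_def by simp
    then have "w t \<in> cell {\<mu>. active \<mu> x}" by (simp add: cell_def)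
    moreover have "cell {\<mu>. active \<mu> x} \<subseteq> cell S"
      using \<open>F \<subseteq> cell S\<close> \<open>x \<in> F\<close> by (auto simp: cell_def)
    ultimately have "w t \<in> cell S" "y \<in> cell S" using y by auto
    show "y \<in> F"
    proof (cases "y = x")
      case False
      have "(1 / (1 + t)) *\<^sub>R w t = x - (t / (1 + t)) *\<^sub>R y"
        using t by (simp add: w_def scaleR_diff_right)
      moreover have "1 - 1 / (1 + t) = t / (1 + t)" using t by (simp add: field_simps)
      ultimately have "x = (1 - 1 / (1 + t)) *\<^sub>R y + (1 / (1 + t)) *\<^sub>R w t" by simp
      moreover have "y \<noteq> w t"
      proof
        assume "y = w t"
        then have "(1 + t) *\<^sub>R x = (1 + t) *\<^sub>R y" by (simp add: w_def algebra_simps)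
        then show False using t False by simp
      qed
      ultimately have "x \<in> open_segment y (w t)"
        using t by (auto simp: in_segment intro!: exI[of _ "1 / (1 + t)"])
      then show ?thesis
        using face_ofD[OF F _ \<open>y \<in> cell S\<close> \<open>w t \<in> cell S\<close> \<open>x \<in> F\<close>] by blast
    qed (use \<open>x \<in> F\<close> in simp)
  qed
qed

text \<open>
  A cell is bounded, so only the finitely many functions that are active somewhere on a large ball
  \<open>K\<close> can bound it: a point outside \<open>K\<close> that satisfies all their inequalities would, by convexity,
  produce such a point on the boundary sphere of \<open>K\<close>, which lies in the cell.
\<close>

lemma cell_eq_halfspaces:
  assumes "S \<noteq> {}" "cell S \<noteq> {}"
  obtains J where "finite J" "J \<subseteq> I \<times> I" "cell S = {x. \<forall>(\<mu>, \<nu>)\<in>J. g \<mu> x \<le> g \<nu> x}"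
proof -
  obtain s y where "s \<in> S" and y: "y \<in> cell S" using assms by blast
  have SI: "S \<subseteq> I" using y by (auto simp: cell_def active_def)
  then have "bounded {x. active s x}"
    using bounded_attaining[of s] \<open>s \<in> S\<close> by (auto simp: active_def g_def)
  then obtain r where r: "r > 0" "{x. active s x} \<subseteq> ball y r"
    using bounded_subset_ballD by blast
  define A where "A = {\<mu>. \<exists>x\<in>cball y r. active \<mu> x}"
  have "finite A" unfolding A_def by (intro finite_active bounded_cball)
  have "A \<subseteq> I" by (auto simp: A_def active_def)
  have "S \<subseteq> {\<mu>. \<exists>x\<in>{y}. active \<mu> x}" using y by (auto simp: cell_def)
  then have "finite S" using finite_active[of "{y}"] finite_subset by blast
  have ball: "active s x" if "x \<in> cball y r" "\<And>\<mu>. \<mu> \<in> A \<Longrightarrow> g \<mu> x \<le> g s x" for x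
  proof -
    obtain \<mu> where "active \<mu> x" using ex_active by blast
    moreover then have "\<mu> \<in> A" using that by (auto simp: A_def)
    ultimately have "h x \<le> g s x" using that by (auto simp: active_def)
    then show ?thesis using g_le[of s x] SI \<open>s \<in> S\<close> by (auto simp: active_def)
  qed
  have all: "active s x" if le: "\<And>\<mu>. \<mu> \<in> A \<Longrightarrow> g \<mu> x \<le> g s x" for x
  proof (rule ccontr)
    assume "\<not> active s x"
    then have "dist y x > r" using ball[OF _ le] by force
    define t where "t = r / dist y x"
    have "dist y x > 0" using r \<open>dist y x > r\<close> by linarith
    then have t: "0 < t" "t < 1" using r \<open>dist y x > r\<close> by (auto simp: t_def divide_simps)
    define w where "w = (1 - t) *\<^sub>R y + t *\<^sub>R x"
    have "dist y w = t * dist y x"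
      using t by (simp add: w_def dist_norm algebra_simps flip: scaleR_diff_right)
    then have "dist y w = r" using \<open>dist y x > r\<close> r by (auto simp: t_def)
    moreover have "active s w"
    proof (rule ball)
      fix \<mu> assume "\<mu> \<in> A"
      then have "g \<mu> y \<le> g s y"
        using g_le[of \<mu> y] \<open>A \<subseteq> I\<close> y \<open>s \<in> S\<close> by (auto simp: cell_def active_def)
      then show "g \<mu> w \<le> g s w"
        using t le[OF \<open>\<mu> \<in> A\<close>] by (simp add: w_def g_comb add_mono mult_left_mono)
    qed (use \<open>dist y w = r\<close> in simp)
    ultimately show False using r by auto
  qed
  have "cell S = {x. \<forall>(\<mu>, \<nu>)\<in>A \<times> {s} \<union> {s} \<times> S. g \<mu> x \<le> g \<nu> x}" (is "_ = ?H")
  proof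
    show "cell S \<subseteq> ?H"
    proof clarify
      fix x \<mu> \<nu> assume x: "x \<in> cell S" and "(\<mu>, \<nu>) \<in> A \<times> {s} \<union> {s} \<times> S"
      then have "\<mu> \<in> I" "\<nu> \<in> S" using \<open>A \<subseteq> I\<close> SI \<open>s \<in> S\<close> by auto
      then show "g \<mu> x \<le> g \<nu> x" using g_le[of \<mu> x] x by (simp add: cell_def active_def)
    qed
    show "?H \<subseteq> cell S"
    proof
      fix x assume x: "x \<in> ?H"
      then have s: "active s x" by (intro all) auto
      have "active \<mu> x" if "\<mu> \<in> S" for \<mu>
      proof -
        have "g s x \<le> g \<mu> x" "\<mu> \<in> I" using x that SI by auto
        then show ?thesis using s g_le[of \<mu> x] by (simp add: active_def)
      qed
      then show "x \<in> cell S" by (simp add: cell_def)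
    qed
  qed
  then show ?thesis
    using \<open>finite A\<close> \<open>finite S\<close> \<open>A \<subseteq> I\<close> SI \<open>s \<in> S\<close> by (intro that[of "A \<times> {s} \<union> {s} \<times> S"]) auto
qed

lemma cell_Int: "cell S \<inter> cell T = cell (S \<union> T)"
  by (auto simp: cell_def)

lemma cell_in_cells: "S \<noteq> {} \<Longrightarrow> cell S \<in> cells"
  by (auto simp: cells_def)

lemma empty_in_cells: "{} \<in> cells"
proof -
  \<comment> \<open>Infinitely many functions cannot be active at the same point.\<close>
  have "x \<notin> cell UNIV" for x
  proof
    assume "x \<in> cell UNIV"
    then have "{\<mu>. \<exists>y\<in>{x}. active \<mu> y} = UNIV" by (auto simp: cell_def)
    then have "finite (UNIV :: 'a set)" using finite_active[of "{x}"] by simp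
    then show False using finite_imp_bounded[of "UNIV :: 'a set"] not_bounded_UNIV[where 'a='a] by simp
  qed
  then have "cell UNIV = {}" by blast
  then show ?thesis using cell_in_cells[of UNIV] by simp
qed

lemma bounded_cell: "S \<noteq> {} \<Longrightarrow> bounded (cell S)"
proof -
  assume "S \<noteq> {}"
  then obtain s where "s \<in> S" by blast
  then have "cell S \<subseteq> (if s \<in> I then {x. h x = b s x + c s} else {})"
    by (simp add: cell_def active_def g_def subset_iff)
  moreover have "bounded (if s \<in> I then {x. h x = b s x + c s} else {})"
    using bounded_attaining[of s] by simp
  ultimately show ?thesis by (rule bounded_subset[rotated])
qed

lemma Union_cells: "\<Union>cells = UNIV"
proof -
  have "\<exists>P\<in>cells. x \<in> P" for x
  proof -
    obtain \<mu> where "active \<mu> x" using ex_active by blast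
    then show ?thesis using cell_in_cells[of "{\<mu>}"] by (force simp: cell_def)
  qed
  then show ?thesis by auto
qed

lemma face_of_cells: "P \<in> cells \<Longrightarrow> F face_of P \<Longrightarrow> F \<in> cells"
proof (cases "F = {}")
  case False
  assume "P \<in> cells" and F: "F face_of P"
  then obtain S where S: "S \<noteq> {}" "P = cell S" using cellsE by blast
  obtain x where "x \<in> rel_interior F"
    using False F face_of_imp_convex rel_interior_eq_empty by blast
  then show ?thesis
    using face_of_cell_rel_interior[OF S(1), of F x] F S(2) cell_in_cells[of "{\<mu>. active \<mu> x}"]
      ex_active[of x] by simp
qed (simp add: empty_in_cells)

lemma finite_cells_meeting:
  assumes "bounded K"
  shows "finite {P \<in> cells. P \<inter> K \<noteq> {}}"
proof (rule finite_subset)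
  show "{P \<in> cells. P \<inter> K \<noteq> {}} \<subseteq> cell ` Pow {\<mu>. \<exists>x\<in>K. active \<mu> x}"
    by (auto simp: cells_def cell_def)
  show "finite (cell ` Pow {\<mu>. \<exists>x\<in>K. active \<mu> x})"
    using finite_active[OF assms] by simp
qed

lemma polyhedron_g_le: "polyhedron {x. g \<mu> x \<le> g \<nu> x}"
proof -
  obtain a where a: "\<And>x. b (\<mu> - \<nu>) x = a \<bullet> x" using b_eq_inner by blast
  have "{x. g \<mu> x \<le> g \<nu> x} = {x. a \<bullet> x \<le> c \<nu> - c \<mu>}"
    by (auto simp: g_def b_simps algebra_simps simp flip: a)
  then show ?thesis by (simp add: polyhedron_halfspace_le)
qed

lemma polyhedral_complex_cells: "polyhedral_complex cells"
  unfolding polyhedral_complex_def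
proof (intro conjI ballI allI impI)
  show "locally_finite_in euclidean cells"
    unfolding locally_finite_in_def
  proof (intro conjI ballI)
    fix x :: 'a
    show "\<exists>V. openin euclidean V \<and> x \<in> V \<and> finite {U \<in> cells. U \<inter> V \<noteq> {}}"
      by (intro exI[of _ "ball x 1"]) (auto intro: finite_cells_meeting)
  qed auto
  show "polyhedron P" if "P \<in> cells" for P
  proof (cases "P = {}")
    case False
    from that obtain S where S: "S \<noteq> {}" "P = cell S" by (rule cellsE)
    have "cell S \<noteq> {}" using False S(2) by simp
    then obtain J where J: "finite J" "cell S = {x. \<forall>(\<mu>, \<nu>)\<in>J. g \<mu> x \<le> g \<nu> x}"
      by (rule cell_eq_halfspaces[OF S(1)])
    have "P = \<Inter>((\<lambda>(\<mu>, \<nu>). {x. g \<mu> x \<le> g \<nu> x}) ` J)" unfolding S(2) J(2) by auto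
    moreover have "polyhedron \<dots>" using J(1) polyhedron_g_le by (intro polyhedron_Inter) auto
    ultimately show ?thesis by simp
  qed simp
  show "P \<inter> Q face_of P" "P \<inter> Q face_of Q" if "P \<in> cells" "Q \<in> cells" for P Q
    using that by (auto elim!: cellsE simp: cell_Int intro!: cell_face_of)
qed (rule face_of_cells)

text \<open>
  Near a relative interior point \<open>x\<close> of a maximal cell \<open>P\<close>, every point lies in a cell of a function
  active at \<open>x\<close>. Such a cell contains \<open>P\<close>, hence equals \<open>P\<close>.
\<close>

lemma maximal_cell:
  assumes "P \<in> maximal_faces cells"
  obtains \<mu> where "\<mu> \<in> I" "P = cell {\<mu>}" "interior P \<noteq> {}"
proof -
  have "P \<in> cells" and max: "\<And>Q. Q \<in> cells \<Longrightarrow> P \<subseteq> Q \<Longrightarrow> Q = P"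
    using assms by (auto simp: maximal_faces_def)
  from \<open>P \<in> cells\<close> obtain S where S: "S \<noteq> {}" "P = cell S" by (rule cellsE)
  have "P \<noteq> {}"
    using max Union_cells by blast
  then obtain x where x: "x \<in> rel_interior P"
    using S convex_cell rel_interior_eq_empty by blast
  have P: "P = cell {\<mu>. active \<mu> x}"
    using face_of_cell_rel_interior[OF S(1) _ x] S convex_cell face_of_refl by blast
  have single: "P = cell {\<mu>}" if "active \<mu> x" for \<mu>
    using max[OF cell_in_cells[of "{\<mu>}"]] P that by (auto simp: cell_def)
  have "\<forall>\<^sub>F y in nhds x. y \<in> P"
    using eventually_active_subset[of x]
  proof eventually_elim
    case (elim y)
    obtain \<nu> where "active \<nu> y" using ex_active by blast
    then show ?case using elim single[of \<nu>] by (auto simp: cell_def)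
  qed
  then have "x \<in> interior P" by (auto simp: eventually_nhds interior_def)
  moreover obtain \<mu> where "active \<mu> x" using ex_active by blast
  ultimately show ?thesis using single that by (auto simp: active_def)
qed

text \<open>Two affine functions that agree on an open set have the same slope.\<close>

lemma slope_on_cell:
  assumes "has_slope_on h u (cell {\<mu>})" "interior (cell {\<mu>}) \<noteq> {}"
  shows "u = b \<mu>"
proof
  fix v :: 'a
  obtain x r where r: "r > 0" "ball x r \<subseteq> cell {\<mu>}"
    using assms(2) mem_interior by blast
  obtain k where u: "linear u" and k: "\<And>x. x \<in> cell {\<mu>} \<Longrightarrow> h x = u x + k"
    using assms(1) by (auto simp: has_slope_on_def)
  have eq: "u y + k = b \<mu> y + c \<mu>" if "y \<in> ball x r" for y
    using k[of y] r that by (auto simp: cell_def active_def g_def)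
  define t where "t = r / (2 * (norm v + 1))"
  have "norm v + 1 > 0" by (simp add: add_nonneg_pos)
  then have "t > 0" using r by (simp add: t_def)
  have "t * norm v \<le> r / 2"
    using r \<open>norm v + 1 > 0\<close> by (simp add: t_def field_simps)
  then have "x + t *\<^sub>R v \<in> ball x r" using \<open>t > 0\<close> r by (simp add: dist_norm)
  then have "u x + t * u v + k = b \<mu> x + t * b \<mu> v + c \<mu>" "u x + k = b \<mu> x + c \<mu>"
    using eq[of x] eq[of "x + t *\<^sub>R v"] r
    by (simp_all add: linear_add[OF u] linear_scale[OF u] b_simps)
  then have "t * u v = t * b \<mu> v" by linarith
  then show "u v = b \<mu> v" using \<open>t > 0\<close> by simp
qed

lemma strictly_convex_h: "strictly_convex_wrt cells h"
  unfolding strictly_convex_wrt_def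
proof (intro conjI ballI allI impI)
  show "convex_on UNIV h" by (rule convex_h)
  show "\<exists>u. has_slope_on h u P" if P: "P \<in> cells" for P
  proof -
    obtain S where S: "S \<noteq> {}" "P = cell S" using P by (rule cellsE)
    then obtain s where "s \<in> S" by blast
    with S(2) have "has_slope_on h (b s) P"
      by (auto simp: has_slope_on_def linear_b cell_def active_def g_def)
    then show ?thesis by blast
  qed
  fix P Q u v
  assume P: "P \<in> maximal_faces cells" and Q: "Q \<in> maximal_faces cells"
    and *: "P \<noteq> Q \<and> has_slope_on h u P \<and> has_slope_on h v Q"
  obtain \<mu> where "P = cell {\<mu>}" "u = b \<mu>" using maximal_cell[OF P] slope_on_cell * by metis
  moreover obtain \<nu> where "Q = cell {\<nu>}" "v = b \<nu>" using maximal_cell[OF Q] slope_on_cell * by metis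
  ultimately show "u \<noteq> v" using b_eqI[of \<mu> \<nu>] * by auto
qed

end

section \<open>Rational points and values in the value group\<close>

locale cocycle_data = pos_def_form b
  for b :: "'a::euclidean_space \<Rightarrow> 'a \<Rightarrow> real" +
  fixes \<Gamma> :: "real set" and N \<Lambda> :: "'a set" and z :: "'a \<Rightarrow> 'a \<Rightarrow> real"
  assumes \<Gamma>: "divisible_subgroup \<Gamma>" "\<Gamma> \<noteq> {0}"
    and N: "full_lattice N"
    and \<Lambda>: "full_lattice \<Lambda>"
    and b_int: "l \<in> \<Lambda> \<Longrightarrow> x \<in> N \<Longrightarrow> b l x \<in> \<int>"
    and z_add: "l \<in> \<Lambda> \<Longrightarrow> m \<in> \<Lambda> \<Longrightarrow> z (l + m) w = z l (w + m) + z m w"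
    and z_affine: "l \<in> \<Lambda> \<Longrightarrow> z l w = z l 0 + b l w"
    and z_\<Gamma>: "l \<in> \<Lambda> \<Longrightarrow> z l 0 \<in> \<Gamma>"
begin

lemma \<Gamma>_0: "0 \<in> \<Gamma>"
  and \<Gamma>_add: "x \<in> \<Gamma> \<Longrightarrow> y \<in> \<Gamma> \<Longrightarrow> x + y \<in> \<Gamma>"
  and \<Gamma>_neg: "x \<in> \<Gamma> \<Longrightarrow> - x \<in> \<Gamma>"
  using \<Gamma>(1) by (auto simp: divisible_subgroup_def)

lemma \<Gamma>_diff: "x \<in> \<Gamma> \<Longrightarrow> y \<in> \<Gamma> \<Longrightarrow> x - y \<in> \<Gamma>"
  using \<Gamma>_add[of x "- y"] \<Gamma>_neg[of y] by simp

lemma \<Gamma>_divide: "x \<in> \<Gamma> \<Longrightarrow> m > 0 \<Longrightarrow> x / real m \<in> \<Gamma>"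
proof -
  assume "x \<in> \<Gamma>" "m > 0"
  then obtain y where "y \<in> \<Gamma>" "real m * y = x"
    using \<Gamma>(1) unfolding divisible_subgroup_def by blast
  then show ?thesis using \<open>m > 0\<close> by (auto simp: field_simps)
qed

lemma \<Gamma>_mult_nat: "x \<in> \<Gamma> \<Longrightarrow> real m * x \<in> \<Gamma>"
  by (induction m) (simp_all add: \<Gamma>_0 \<Gamma>_add distrib_right)

lemma \<Gamma>_mult_int: "x \<in> \<Gamma> \<Longrightarrow> of_int k * x \<in> \<Gamma>"
  using \<Gamma>_mult_nat[of x "nat k"] \<Gamma>_neg[OF \<Gamma>_mult_nat[of x "nat (- k)"]] by (cases "k \<ge> 0") auto

lemma \<Gamma>_pos: obtains x where "x \<in> \<Gamma>" "x > 0"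
proof -
  obtain x where "x \<in> \<Gamma>" "x \<noteq> 0" using \<Gamma>(2) \<Gamma>_0 by blast
  then show ?thesis using that[of x] that[of "- x"] \<Gamma>_neg[of x] by (cases "x > 0") auto
qed

text \<open>By divisibility \<open>\<Gamma>\<close> contains arbitrarily small positive elements \<open>a / m\<close>.\<close>

lemma \<Gamma>_dense:
  assumes "e > 0"
  shows "\<exists>y\<in>\<Gamma>. \<bar>y - x\<bar> \<le> e"
proof -
  obtain a where a: "a \<in> \<Gamma>" "a > 0" by (rule \<Gamma>_pos)
  obtain m :: nat where m: "a / e < real m" using reals_Archimedean2 by blast
  moreover have "a / e > 0" using a assms by simp
  ultimately have "m > 0" by (intro gr0I) auto
  define d where "d = a / real m"
  have d: "d \<in> \<Gamma>" "d > 0" "d \<le> e"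
    using a \<Gamma>_divide \<open>m > 0\<close> m assms by (auto simp: d_def field_simps)
  have "\<bar>of_int \<lfloor>x / d\<rfloor> * d - x\<bar> = d * \<bar>of_int \<lfloor>x / d\<rfloor> - x / d\<bar>"
  proof -
    have "of_int \<lfloor>x / d\<rfloor> * d - x = d * (of_int \<lfloor>x / d\<rfloor> - x / d)"
      using d by (simp add: field_simps)
    then show ?thesis using d by (simp add: abs_mult)
  qed
  also have "\<dots> \<le> d * 1"
    using d by (intro mult_left_mono) linarith+
  finally show ?thesis using d \<Gamma>_mult_int[of d "\<lfloor>x / d\<rfloor>"] by (intro bexI[of _ "of_int \<lfloor>x / d\<rfloor> * d"]) auto
qed

lemmas \<Lambda>_closed = full_lattice_0[OF \<Lambda>] full_lattice_add[OF \<Lambda>] full_lattice_neg[OF \<Lambda>]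

lemma \<Lambda>_mult_nat: "x \<in> \<Lambda> \<Longrightarrow> real m *\<^sub>R x \<in> \<Lambda>"
  using full_lattice_scaleR_int[OF \<Lambda>, of x "int m"] by simp

lemma z_0: "z 0 w = 0"
  using z_add[of 0 0 w] \<Lambda>_closed by simp

lemma z_neg: "l \<in> \<Lambda> \<Longrightarrow> z (- l) (w + l) = - z l w"
  using z_add[of "- l" l w] \<Lambda>_closed z_0 by simp

lemma z_add_0: "l \<in> \<Lambda> \<Longrightarrow> m \<in> \<Lambda> \<Longrightarrow> z (l + m) 0 = z l 0 + b l m + z m 0"
  using z_add[of l m 0] z_affine[of l m] by simp

text \<open>
  The form \<open>b\<close> measures the failure of \<open>l \<mapsto> z l 0\<close> to be additive, so it inherits its values from
  the cocycle.
\<close>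

lemma b_\<Lambda>_in_\<Gamma>: "l \<in> \<Lambda> \<Longrightarrow> m \<in> \<Lambda> \<Longrightarrow> b l m \<in> \<Gamma>"
proof -
  assume lm: "l \<in> \<Lambda>" "m \<in> \<Lambda>"
  then have "b l m = z (l + m) 0 - z l 0 - z m 0" using z_add_0 by simp
  then show ?thesis using lm z_\<Gamma> \<Lambda>_closed by (simp add: \<Gamma>_diff)
qed

text \<open>
  The points of \<open>\<Lambda> \<otimes> \<rat>\<close>; via \<open>b\<close> they give slopes that are rational with respect to \<open>N\<close>.
\<close>

definition rational :: "'a set" where
  "rational = {x. \<exists>m>0. real m *\<^sub>R x \<in> \<Lambda>}"

lemma rationalE:
  assumes "x \<in> rational"
  obtains m where "m > 0" "real m *\<^sub>R x \<in> \<Lambda>"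
  using assms by (auto simp: rational_def)

lemma rational_add: "x \<in> rational \<Longrightarrow> y \<in> rational \<Longrightarrow> x + y \<in> rational"
proof -
  assume "x \<in> rational" "y \<in> rational"
  then obtain m k where mk: "m > 0" "real m *\<^sub>R x \<in> \<Lambda>" "k > 0" "real k *\<^sub>R y \<in> \<Lambda>"
    by (metis rationalE)
  have "real (m * k) *\<^sub>R (x + y) = real k *\<^sub>R (real m *\<^sub>R x) + real m *\<^sub>R (real k *\<^sub>R y)"
    by (simp add: algebra_simps)
  also have "\<dots> \<in> \<Lambda>" by (rule \<Lambda>_closed(2)[OF \<Lambda>_mult_nat[OF mk(2)] \<Lambda>_mult_nat[OF mk(4)]])
  finally show ?thesis unfolding rational_def using mk by (intro CollectI exI[of _ "m * k"]) auto
qed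

lemma rational_neg: "x \<in> rational \<Longrightarrow> - x \<in> rational"
  using \<Lambda>_closed(3) unfolding rational_def by fastforce

lemma rational_diff: "x \<in> rational \<Longrightarrow> y \<in> rational \<Longrightarrow> x - y \<in> rational"
  using rational_add[of x "- y"] rational_neg[of y] by simp

lemma b_rational_in_\<Gamma>: "x \<in> rational \<Longrightarrow> y \<in> rational \<Longrightarrow> b x y \<in> \<Gamma>"
proof -
  assume "x \<in> rational" "y \<in> rational"
  then obtain m k where mk: "m > 0" "real m *\<^sub>R x \<in> \<Lambda>" "k > 0" "real k *\<^sub>R y \<in> \<Lambda>"
    by (metis rationalE)
  have "b x y = b (real m *\<^sub>R x) (real k *\<^sub>R y) / real (m * k)"
    using mk by (simp add: b_simps)
  also have "\<dots> \<in> \<Gamma>" using mk by (intro \<Gamma>_divide b_\<Lambda>_in_\<Gamma>) auto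
  finally show ?thesis .
qed

lemma scaled_lattice_covering:
  obtains R where "R > 0" "\<And>m x. m > 0 \<Longrightarrow> \<exists>y. real m *\<^sub>R y \<in> \<Lambda> \<and> norm (x - y) \<le> R / real m"
proof -
  obtain R where R: "R > 0" "\<And>x. \<exists>l\<in>\<Lambda>. norm (x - l) \<le> R"
    using full_lattice_covering[OF \<Lambda>] by metis
  have "\<exists>y. real m *\<^sub>R y \<in> \<Lambda> \<and> norm (x - y) \<le> R / real m" if "m > 0" for m x
  proof -
    obtain l where l: "l \<in> \<Lambda>" "norm (real m *\<^sub>R x - l) \<le> R" using R(2) by blast
    have "norm (x - l /\<^sub>R real m) = norm (real m *\<^sub>R x - l) / real m"
    proof -
      have "x - l /\<^sub>R real m = (real m *\<^sub>R x - l) /\<^sub>R real m" using that by (simp add: scaleR_diff_right)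
      then show ?thesis by (simp add: divide_inverse mult.commute)
    qed
    also have "\<dots> \<le> R / real m" using l by (simp add: divide_right_mono)
    finally show ?thesis using l that by (intro exI[of _ "l /\<^sub>R real m"]) simp
  qed
  then show ?thesis using R(1) that by blast
qed

lemma rational_dense:
  assumes "e > 0"
  shows "\<exists>t\<in>rational. norm (x - t) < e"
proof -
  obtain R where R: "R > 0" "\<And>m x. m > 0 \<Longrightarrow> \<exists>y. real m *\<^sub>R y \<in> \<Lambda> \<and> norm (x - y) \<le> R / real m"
    using scaled_lattice_covering by metis
  obtain m :: nat where m: "R / e < real m" using reals_Archimedean2 by blast
  moreover have "R / e > 0" using R(1) assms by simp
  ultimately have "m > 0" by (intro gr0I) auto
  then obtain y where "real m *\<^sub>R y \<in> \<Lambda>" "norm (x - y) \<le> R / real m" using R(2) by blast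
  moreover have "R / real m < e" using m \<open>m > 0\<close> assms by (simp add: field_simps)
  ultimately show ?thesis using \<open>m > 0\<close> by (intro bexI[of _ y]) (auto simp: rational_def)
qed

lemma affine_functions_b_int: "l \<in> \<Lambda> \<Longrightarrow> a \<in> \<Gamma> \<Longrightarrow> (\<lambda>x. b l x + a) \<in> affine_functions N \<int> \<Gamma>"
  unfolding affine_functions_def dual_module_def using b_int linear_b by blast

lemma affine_functions_b_rational:
  assumes "\<mu> \<in> rational" "a \<in> \<Gamma>"
  shows "(\<lambda>x. b \<mu> x + a) \<in> affine_functions N \<rat> \<Gamma>"
proof -
  obtain m where m: "m > 0" "real m *\<^sub>R \<mu> \<in> \<Lambda>" using assms(1) by (rule rationalE)
  have "b \<mu> x \<in> \<rat>" if "x \<in> N" for x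
  proof -
    have "b (real m *\<^sub>R \<mu>) x \<in> \<rat>" using b_int[OF m(2) that] Ints_subset_Rats by blast
    then have "b (real m *\<^sub>R \<mu>) x / real m \<in> \<rat>" by simp
    then show ?thesis using m by (simp add: b_simps)
  qed
  then show ?thesis
    using assms(2) linear_b[of \<mu>] unfolding affine_functions_def dual_module_def by blast
qed

end

lemma affine_functions_mono: "R \<subseteq> R' \<Longrightarrow> affine_functions N R \<Gamma> \<subseteq> affine_functions N R' \<Gamma>"
  by (auto simp: affine_functions_def dual_module_def)

section \<open>Periodic maxima of affine functions\<close>

text \<open>
  The last assumption says that no cell meets one of its proper translates. The equivariance of the
  constants makes the translation action \<open>x \<mapsto> x + l\<close> carry the function with slope \<open>\<mu>\<close> to the
  function with slope \<open>\<mu> + l\<close>, up to the cocycle.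
\<close>

locale periodic_family = tropical_family b I c h + cocycle_data b \<Gamma> N \<Lambda> z
  for b :: "'a::euclidean_space \<Rightarrow> 'a \<Rightarrow> real" and I c h \<Gamma> N \<Lambda> z +
  assumes slopes: "\<mu> \<in> I \<Longrightarrow> \<mu> \<in> rational"
    and constants: "\<mu> \<in> I \<Longrightarrow> c \<mu> \<in> \<Gamma>"
    and equivariant: "\<mu> \<in> I \<Longrightarrow> l \<in> \<Lambda> \<Longrightarrow>
      \<mu> + l \<in> I \<and> c (\<mu> + l) = c \<mu> - b \<mu> l + z l 0 - b l l"
    and small: "\<mu> \<in> I \<Longrightarrow> l \<in> \<Lambda> \<Longrightarrow> h x = b \<mu> x + c \<mu> \<Longrightarrow>
      h (x + l) = b \<mu> (x + l) + c \<mu> \<Longrightarrow> l = 0"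
begin

lemma g_translate:
  assumes "\<mu> \<in> I" "l \<in> \<Lambda>"
  shows "g (\<mu> + l) (x + l) = g \<mu> x + z l x"
  using equivariant[OF assms] z_affine[OF assms(2), of x] by (simp add: g_def b_simps)

text \<open>
  Translating an active function bounds \<open>h\<close> at \<open>x + l\<close> from below. Applying this to \<open>- l\<close> gives the
  reverse inequality.
\<close>

lemma cocycle_rule_h: "cocycle_rule \<Lambda> z h"
  unfolding cocycle_rule_def
proof (intro ballI allI)
  have ge: "h (x + l) \<ge> h x + z l x" if "l \<in> \<Lambda>" for x l
  proof -
    obtain \<mu> where \<mu>: "active \<mu> x" using ex_active by blast
    then have "h x + z l x = g (\<mu> + l) (x + l)" using that by (simp add: active_def g_translate)
    also have "\<dots> \<le> h (x + l)" using \<mu> that equivariant by (intro g_le) (simp add: active_def)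
    finally show ?thesis .
  qed
  fix l w assume "l \<in> \<Lambda>"
  then show "h (w + l) = h w + z l w"
    using ge[of l w] ge[of "- l" "w + l"] z_neg[of l w] \<Lambda>_closed(3)[of l] by simp
qed

lemma active_translate:
  assumes "active \<mu> x" "l \<in> \<Lambda>"
  shows "active (\<mu> + l) (x + l)"
  using assms equivariant[of \<mu> l] cocycle_rule_h
  by (simp add: active_def g_translate cocycle_rule_def)

lemma periodic_cells: "periodic_complex \<Lambda> cells"
  unfolding periodic_complex_def
proof (intro ballI conjI)
  fix P l assume "P \<in> cells" and l: "l \<in> \<Lambda> - {0}"
  then obtain S where S: "S \<noteq> {}" "P = cell S" using cellsE by blast
  have "(+) l ` cell S = cell ((+) l ` S)"
  proof
    show "(+) l ` cell S \<subseteq> cell ((+) l ` S)"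
      using active_translate l by (auto simp: cell_def add.commute[of l])
    show "cell ((+) l ` S) \<subseteq> (+) l ` cell S"
    proof
      fix x assume x: "x \<in> cell ((+) l ` S)"
      have "active \<mu> (x - l)" if "\<mu> \<in> S" for \<mu>
        using active_translate[of "l + \<mu>" x "- l"] x that l \<Lambda>_closed(3) by (auto simp: cell_def)
      then show "x \<in> (+) l ` cell S" by (intro image_eqI[of _ _ "x - l"]) (auto simp: cell_def)
    qed
  qed
  then show "(+) l ` P \<in> cells" using S cell_in_cells by auto
  show "(+) l ` P \<inter> P = {}"
  proof (rule equals0I)
    fix x assume "x \<in> (+) l ` P \<inter> P"
    then obtain y where y: "y \<in> cell S" "y + l \<in> cell S" using S by (auto simp: add.commute)
    obtain s where "s \<in> S" using S by blast
    then have "l = 0" using y l small[of s l y] by (auto simp: cell_def active_def g_def)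
    then show False using l by simp
  qed
qed

lemma RG_polytope_cells:
  assumes "P \<in> cells"
  shows "RG_polytope N \<int> \<Gamma> P"
proof -
  obtain S where S: "S \<noteq> {}" "P = cell S" using assms by (rule cellsE)
  have "RG_polyhedron N \<int> \<Gamma> (cell S)"
  proof (cases "cell S = {}")
    case True
    obtain a where a: "a \<in> \<Gamma>" "a > 0" by (rule \<Gamma>_pos)
    have "(\<lambda>x. b 0 x + a) \<in> affine_functions N \<int> \<Gamma>" using a \<Lambda>_closed by (intro affine_functions_b_int)
    then show ?thesis
      unfolding RG_polyhedron_def True using a
      by (intro exI[of _ "{\<lambda>x. b 0 x + a}"]) (auto simp: b_simps)
  next
    case False
    then obtain J where J: "finite J" "J \<subseteq> I \<times> I" "cell S = {x. \<forall>(\<mu>, \<nu>)\<in>J. g \<mu> x \<le> g \<nu> x}"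
      by (rule cell_eq_halfspaces[OF S(1)])
    \<comment> \<open>Clearing denominators makes the slopes integral; the constants stay in the group.\<close>
    have "\<exists>G\<in>affine_functions N \<int> \<Gamma>. \<forall>x. G x \<le> 0 \<longleftrightarrow> g \<mu> x \<le> g \<nu> x" if "(\<mu>, \<nu>) \<in> J" for \<mu> \<nu>
    proof -
      have I: "\<mu> \<in> I" "\<nu> \<in> I" using that J by auto
      then obtain m where m: "m > 0" "real m *\<^sub>R (\<mu> - \<nu>) \<in> \<Lambda>"
        using slopes rational_diff by (meson rationalE)
      let ?G = "\<lambda>x. b (real m *\<^sub>R (\<mu> - \<nu>)) x + real m * (c \<mu> - c \<nu>)"
      have "?G \<in> affine_functions N \<int> \<Gamma>"
        using m I constants by (intro affine_functions_b_int \<Gamma>_mult_nat \<Gamma>_diff) auto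
      moreover have "?G x = real m * (g \<mu> x - g \<nu> x)" for x
        by (simp add: b_simps g_def algebra_simps)
      ultimately show ?thesis using m by (intro bexI[of _ ?G]) (auto simp: mult_le_0_iff)
    qed
    then obtain G where G: "\<And>\<mu> \<nu>. (\<mu>, \<nu>) \<in> J \<Longrightarrow> G (\<mu>, \<nu>) \<in> affine_functions N \<int> \<Gamma>"
        "\<And>\<mu> \<nu> x. (\<mu>, \<nu>) \<in> J \<Longrightarrow> G (\<mu>, \<nu>) x \<le> 0 \<longleftrightarrow> g \<mu> x \<le> g \<nu> x"
      using bchoice[of J "\<lambda>p G. G \<in> affine_functions N \<int> \<Gamma> \<and> (\<forall>x. G x \<le> 0 \<longleftrightarrow> g (fst p) x \<le> g (snd p) x)"]
      by force
    have "cell S = {x. \<forall>G\<in>G ` J. G x \<le> 0}" using J(3) G(2) by auto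
    moreover have "G ` J \<subseteq> affine_functions N \<int> \<Gamma>" using G(1) by auto
    ultimately show ?thesis unfolding RG_polyhedron_def using J(1) by blast
  qed
  then show ?thesis using S bounded_cell by (simp add: RG_polytope_def)
qed

lemma RG_polytopal_decomposition_cells: "RG_polytopal_decomposition N \<int> \<Gamma> cells"
  using polyhedral_complex_cells Union_cells RG_polytope_cells
  by (simp add: RG_polytopal_decomposition_def)

lemma piecewise_RG_linear_h: "piecewise_RG_linear N \<rat> \<Gamma> h"
  unfolding piecewise_RG_linear_def
proof (intro exI[of _ cells] conjI ballI)
  fix P assume P: "P \<in> cells"
  show "RG_polyhedron N \<rat> \<Gamma> P"
    using RG_polytope_cells[OF P] affine_functions_mono[OF Ints_subset_Rats, of N \<Gamma>]
    unfolding RG_polytope_def RG_polyhedron_def by blast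
  obtain S where S: "S \<noteq> {}" "P = cell S" using P by (rule cellsE)
  show "\<exists>G\<in>affine_functions N \<rat> \<Gamma>. \<forall>x\<in>P. h x = G x"
  proof (cases "P = {}")
    case True
    have "(\<lambda>x. b 0 x + 0) \<in> affine_functions N \<rat> \<Gamma>"
      using \<Lambda>_closed \<Gamma>_0 by (intro affine_functions_b_rational) (auto simp: rational_def)
    then show ?thesis using True by blast
  next
    case False
    then obtain s where s: "s \<in> S" "s \<in> I" using S by (auto simp: cell_def active_def)
    then have "(\<lambda>x. b s x + c s) \<in> affine_functions N \<rat> \<Gamma>"
      by (intro affine_functions_b_rational slopes constants)
    then show ?thesis using s S
      by (intro bexI[of _ "\<lambda>x. b s x + c s"]) (auto simp: cell_def active_def g_def)
  qed
qed (simp_all add: polyhedral_complex_cells Union_cells)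

end
section \<open>Transversality by translation\<close>

text \<open>
  A face \<open>F\<close> of a member of \<open>\<Sigma>\<close> and a face \<open>G\<close> of a cell are in bad position if a functional
  \<open>a \<noteq> 0\<close> is constant on both. The translates of \<open>G\<close> by \<open>t\<close> that meet \<open>F\<close> then all have the same
  value \<open>a \<bullet> t\<close>, so \<open>t\<close> only has to avoid one hyperplane for each of the finitely many pairs that
  can meet at all.
\<close>

lemma generic_translate_transversal:
  fixes \<Sigma> \<C> :: "'a::euclidean_space set set"
  assumes \<Sigma>: "finite \<Sigma>" "\<And>\<sigma>. \<sigma> \<in> \<Sigma> \<Longrightarrow> polytope \<sigma>"
      "\<And>\<sigma> F. \<sigma> \<in> \<Sigma> \<Longrightarrow> F face_of \<sigma> \<Longrightarrow> F \<noteq> {} \<Longrightarrow> F \<in> \<Sigma>"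
    and \<C>: "\<And>P. P \<in> \<C> \<Longrightarrow> convex P" "\<And>P F. P \<in> \<C> \<Longrightarrow> F face_of P \<Longrightarrow> F \<in> \<C>"
      "\<And>K. bounded K \<Longrightarrow> finite {P \<in> \<C>. P \<inter> K \<noteq> {}}"
    and dense: "\<And>x r. r > 0 \<Longrightarrow> \<exists>t\<in>D. norm (x - t) < r" and "e > 0"
  shows "\<exists>t\<in>D. norm t < e \<and> transversal_to \<Sigma> ((`) ((+) t) ` \<C>)"
proof -
  define K where "K = (\<Union>x\<in>\<Union>\<Sigma>. \<Union>t\<in>ball 0 1. {x - t})"
  have "bounded (\<Union>\<Sigma>)" using \<Sigma> polytope_imp_bounded by (intro bounded_Union) auto
  then have "bounded K" unfolding K_def by (rule bounded_differences) (rule bounded_ball)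
  define bad where "bad p \<longleftrightarrow> (\<exists>a \<beta>. a \<noteq> 0 \<and> (\<forall>x\<in>fst p. \<forall>y\<in>snd p. a \<bullet> (x - y) = \<beta>))" for p :: "'a set \<times> 'a set"
  define W where "W = {p \<in> \<Sigma> \<times> {P \<in> \<C>. P \<inter> K \<noteq> {}}. bad p}"
  have "finite W" unfolding W_def using \<Sigma>(1) \<C>(3)[OF \<open>bounded K\<close>] by simp
  have "\<forall>p\<in>W. \<exists>n. fst n \<noteq> 0 \<and> (\<forall>x\<in>fst p. \<forall>y\<in>snd p. fst n \<bullet> (x - y) = snd n)"
    unfolding W_def bad_def by force
  then obtain n where n: "\<And>p. p \<in> W \<Longrightarrow> fst (n p) \<noteq> 0"
      "\<And>p x y. p \<in> W \<Longrightarrow> x \<in> fst p \<Longrightarrow> y \<in> snd p \<Longrightarrow> fst (n p) \<bullet> (x - y) = snd (n p)"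
    using bchoice[of W] by metis
  have "finite (n ` W)" using \<open>finite W\<close> by simp
  moreover have "a \<noteq> 0" if "(a, \<beta>) \<in> n ` W" for a \<beta>
    using that n(1) by (metis fst_conv imageE)
  moreover have "min e 1 > 0" using \<open>e > 0\<close> by simp
  ultimately obtain t where t: "t \<in> D" "norm t < min e 1"
    and avoid: "\<And>a \<beta>. (a, \<beta>) \<in> n ` W \<Longrightarrow> a \<bullet> t \<noteq> \<beta>"
    using dense_avoids_hyperplanes[of D "n ` W" "min e 1"] dense by metis
  have "transversal_to \<Sigma> ((`) ((+) t) ` \<C>)"
    unfolding transversal_to_def
  proof (intro ballI impI)
    fix \<sigma> Q assume \<sigma>: "\<sigma> \<in> \<Sigma>" and "Q \<in> (`) ((+) t) ` \<C>" and ne: "\<sigma> \<inter> Q \<noteq> {}"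
    then obtain P where P: "P \<in> \<C>" "Q = (+) t ` P" by blast
    obtain x where x: "x \<in> \<sigma>" "x \<in> Q" using ne by blast
    have "aff_dim (\<sigma> \<inter> Q) = aff_dim \<sigma> + aff_dim Q - int DIM('a)"
    proof (rule aff_dim_Int_transversal)
      show "convex \<sigma>" using \<sigma> \<Sigma>(2) polytope_imp_convex by blast
      show "convex Q" using P \<C>(1) convex_translation by blast
      fix F G a assume F: "F face_of \<sigma>" and G: "G face_of Q" and xF: "x \<in> F" "x \<in> G"
        and aF: "\<And>y. y \<in> F \<Longrightarrow> a \<bullet> y = a \<bullet> x" and aG: "\<And>y. y \<in> G \<Longrightarrow> a \<bullet> y = a \<bullet> x"
      show "a = 0"
      proof (rule ccontr)
        assume "a \<noteq> 0"
        define G' where "G' = (+) (- t) ` G"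
        have "F \<in> \<Sigma>" using \<Sigma>(3)[OF \<sigma> F] xF by blast
        have "(+) t ` G' = G" by (simp add: G'_def image_image)
        then have "G' \<in> \<C>" using \<C>(2)[OF P(1)] G face_of_translation_eq[of t G' P] P(2) by simp
        have xt: "x - t \<in> G'" using xF by (auto simp: G'_def)
        have "x - t \<in> K" unfolding K_def
          using \<open>F \<in> \<Sigma>\<close> xF t by (intro UN_I[of x] UN_I[of t] UnionI[of F]) auto
        have "a \<bullet> (y - w) = a \<bullet> t" if "y \<in> F" "w \<in> G'" for y w
        proof -
          have "w + t \<in> G" using that(2) by (auto simp: G'_def)
          then show ?thesis using aF[OF that(1)] aG[of "w + t"] by (simp add: inner_diff_right inner_add_right)
        qed
        then have "bad (F, G')" unfolding bad_def using \<open>a \<noteq> 0\<close> by auto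
        then have "(F, G') \<in> W"
          unfolding W_def using \<open>F \<in> \<Sigma>\<close> \<open>G' \<in> \<C>\<close> xt \<open>x - t \<in> K\<close> by auto
        moreover from this have "fst (n (F, G')) \<bullet> (x - (x - t)) = snd (n (F, G'))"
          using xF xt by (intro n(2)) auto
        ultimately show False
          using avoid[of "fst (n (F, G'))" "snd (n (F, G'))"] by simp
      qed
    qed (use x in auto)
    then show "aff_dim (\<sigma> \<inter> Q) = aff_dim Q + aff_dim \<sigma> - int DIM('a)" by simp
  qed
  then show ?thesis using t by (intro bexI[of _ t]) auto
qed

text \<open>
  Translating \<open>h\<close> by \<open>t\<close> changes its cocycle at \<open>l\<close> by \<open>- b t l\<close>; adding \<open>b t\<close> to \<open>h\<close> restores it and
  shifts all slopes by \<open>t\<close>. For rational \<open>t\<close> the slopes stay rational and the constants stay in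
  \<open>\<Gamma>\<close>, because \<open>b\<close> takes values in \<open>\<Gamma>\<close> on rational points.
\<close>

lemma (in periodic_family) translate:
  assumes t: "t \<in> rational"
  defines "I' \<equiv> (+) t ` I" and "c' \<equiv> \<lambda>\<mu>. c (\<mu> - t) - b (\<mu> - t) t" and "h' \<equiv> \<lambda>x. h (x - t) + b t x"
  shows "periodic_family b I' c' h' \<Gamma> N \<Lambda> z"
    and "tropical_family.cells b I' c' h' = (`) ((+) t) ` cells"
proof -
  have g': "b (t + \<mu>) x + c' (t + \<mu>) = b \<mu> (x - t) + c \<mu> + b t x" for \<mu> x
    by (simp add: c'_def b_simps b_sym[of \<mu> t])
  have eq: "h' x = b (t + \<mu>) x + c' (t + \<mu>) \<longleftrightarrow> h (x - t) = b \<mu> (x - t) + c \<mu>" for \<mu> x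
    unfolding g' h'_def by simp
  interpret T: tropical_family b I' c' h'
  proof
    fix \<mu> x assume "\<mu> \<in> I'"
    then obtain \<nu> where "\<nu> \<in> I" "\<mu> = t + \<nu>" by (auto simp: I'_def)
    then show "b \<mu> x + c' \<mu> \<le> h' x" using upper[of \<nu> "x - t"] by (simp add: g' h'_def)
  next
    fix x
    obtain \<nu> where "\<nu> \<in> I" "h (x - t) = b \<nu> (x - t) + c \<nu>" using attained by blast
    then show "\<exists>\<mu>\<in>I'. h' x = b \<mu> x + c' \<mu>" unfolding I'_def by (auto simp: eq)
  next
    fix K :: "'a set" assume "bounded K"
    then have "bounded ((+) (- t) ` K)" by (rule bounded_translation)
    then have "finite ((+) t ` {\<mu>\<in>I. \<exists>x\<in>(+) (- t) ` K. h x = b \<mu> x + c \<mu>})"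
      using finite_attaining by blast
    moreover have "{\<mu>\<in>I'. \<exists>x\<in>K. h' x = b \<mu> x + c' \<mu>} \<subseteq>
        (+) t ` {\<mu>\<in>I. \<exists>x\<in>(+) (- t) ` K. h x = b \<mu> x + c \<mu>}"
    proof
      fix \<mu> assume "\<mu> \<in> {\<mu>\<in>I'. \<exists>x\<in>K. h' x = b \<mu> x + c' \<mu>}"
      then obtain \<nu> x where "\<nu> \<in> I" "\<mu> = t + \<nu>" "x \<in> K" "h' x = b \<mu> x + c' \<mu>"
        by (auto simp: I'_def)
      then show "\<mu> \<in> (+) t ` {\<mu>\<in>I. \<exists>x\<in>(+) (- t) ` K. h x = b \<mu> x + c \<mu>}"
        by (intro image_eqI[of _ _ \<nu>]) (auto simp: eq)
    qed
    ultimately show "finite {\<mu>\<in>I'. \<exists>x\<in>K. h' x = b \<mu> x + c' \<mu>}" by (rule rev_finite_subset)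
  next
    fix \<mu> assume "\<mu> \<in> I'"
    then obtain \<nu> where \<nu>: "\<nu> \<in> I" "\<mu> = t + \<nu>" by (auto simp: I'_def)
    have "{x. h' x = b \<mu> x + c' \<mu>} \<subseteq> (+) t ` {x. h x = b \<nu> x + c \<nu>}"
    proof
      fix x assume "x \<in> {x. h' x = b \<mu> x + c' \<mu>}"
      then show "x \<in> (+) t ` {x. h x = b \<nu> x + c \<nu>}"
        by (intro image_eqI[of _ _ "x - t"]) (simp_all add: \<nu> eq)
    qed
    then show "bounded {x. h' x = b \<mu> x + c' \<mu>}"
      using bounded_translation[OF bounded_attaining[OF \<nu>(1)], of t] bounded_subset by blast
  qed
  show "periodic_family b I' c' h' \<Gamma> N \<Lambda> z"
  proof
    fix \<mu> l x assume "\<mu> \<in> I'"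
    then obtain \<nu> where \<nu>: "\<nu> \<in> I" "\<mu> = t + \<nu>" by (auto simp: I'_def)
    show "\<mu> \<in> rational" using \<nu> t slopes by (simp add: rational_add)
    show "c' \<mu> \<in> \<Gamma>" using \<nu> t slopes constants by (simp add: c'_def \<Gamma>_diff b_rational_in_\<Gamma>)
    assume l: "l \<in> \<Lambda>"
    have "t + \<nu> + l - t = \<nu> + l" by simp
    then show "\<mu> + l \<in> I' \<and> c' (\<mu> + l) = c' \<mu> - b \<mu> l + z l 0 - b l l"
      using equivariant[OF \<nu>(1) l] b_sym[of l t] unfolding I'_def \<nu>(2) c'_def
      by (auto simp: b_simps add.assoc)
    assume "h' x = b \<mu> x + c' \<mu>" "h' (x + l) = b \<mu> (x + l) + c' \<mu>"
    then have "h (x - t) = b \<nu> (x - t) + c \<nu>" "h (x - t + l) = b \<nu> (x - t + l) + c \<nu>"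
      unfolding \<nu>(2) eq by (simp_all add: algebra_simps)
    then show "l = 0" by (rule small[OF \<nu>(1) l])
  qed
  have act: "T.active \<mu> x \<longleftrightarrow> active (\<mu> - t) (x - t)" for \<mu> x
  proof -
    have "\<mu> \<in> I' \<longleftrightarrow> \<mu> - t \<in> I" unfolding I'_def by (auto intro: image_eqI[of _ _ "\<mu> - t"])
    then show ?thesis using eq[of x "\<mu> - t"] by (simp add: T.active_def T.g_def active_def g_def)
  qed
  have cell_T: "T.cell ((+) t ` S) = (+) t ` cell S" for S
  proof
    show "T.cell ((+) t ` S) \<subseteq> (+) t ` cell S"
    proof
      fix x assume "x \<in> T.cell ((+) t ` S)"
      then have "T.active (t + \<mu>) x" if "\<mu> \<in> S" for \<mu>
        using that by (simp add: T.cell_def)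
      then have "x - t \<in> cell S" by (simp add: act cell_def)
      then show "x \<in> (+) t ` cell S" by (intro image_eqI[of _ _ "x - t"]) auto
    qed
    show "(+) t ` cell S \<subseteq> T.cell ((+) t ` S)"
    proof
      fix x assume "x \<in> (+) t ` cell S"
      then have "x - t \<in> cell S" by auto
      then have "T.active (t + \<mu>) x" if "\<mu> \<in> S" for \<mu>
        using that by (simp add: act cell_def)
      then show "x \<in> T.cell ((+) t ` S)" by (simp add: T.cell_def)
    qed
  qed
  show "T.cells = (`) ((+) t) ` cells"
  proof (intro equalityI subsetI)
    fix P assume "P \<in> (`) ((+) t) ` cells"
    then obtain Q where Q: "Q \<in> cells" "P = (+) t ` Q" by (rule imageE) metis
    from Q(1) obtain S where S: "S \<noteq> {}" "Q = cell S" by (rule cellsE)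
    have "P = T.cell ((+) t ` S)" by (simp only: cell_T Q(2) S(2))
    then show "P \<in> T.cells" using S(1) by (simp add: T.cell_in_cells)
  next
    fix P assume "P \<in> T.cells"
    then obtain S where S: "S \<noteq> {}" "P = T.cell S" by (rule T.cellsE)
    have "(+) t ` (+) (- t) ` S = S" by (simp add: image_image)
    then have "P = (+) t ` cell ((+) (- t) ` S)"
      using S(2) cell_T[of "(+) (- t) ` S"] by simp
    moreover have "cell ((+) (- t) ` S) \<in> cells" using S(1) by (intro cell_in_cells) simp
    ultimately show "P \<in> (`) ((+) t) ` cells" by (rule image_eqI)
  qed
qed

section \<open>Approximation of strongly convex functions\<close>

context cocycle_data
begin

text \<open>
  The cocycle relation makes \<open>l \<mapsto> z l 0 - b l l / 2\<close> additive. With \<open>b v\<close> its linear extension,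
  the quadratic function \<open>x \<mapsto> b x x / 2 + b v x\<close> satisfies the cocycle rule.
\<close>

lemma linear_part:
  obtains v where "\<And>l. l \<in> \<Lambda> \<Longrightarrow> b v l = z l 0 - b l l / 2"
proof -
  have "z (l + m) 0 - b (l + m) (l + m) / 2 = (z l 0 - b l l / 2) + (z m 0 - b m m / 2)"
    if "l \<in> \<Lambda>" "m \<in> \<Lambda>" for l m
    using z_add_0[OF that] by (simp add: b_simps b_sym[of m l] field_simps)
  then obtain u where u: "linear u" "\<And>l. l \<in> \<Lambda> \<Longrightarrow> u l = z l 0 - b l l / 2"
    using full_lattice_additive_extension[OF \<Lambda>, of "\<lambda>l. z l 0 - b l l / 2"] by metis
  obtain v where "\<And>x. b v x = adjoint u 1 \<bullet> x" using b_represents by metis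
  moreover have "adjoint u 1 \<bullet> x = u x" for x
    using adjoint_works[OF u(1), of x 1] by (simp add: inner_commute)
  ultimately have "b v l = z l 0 - b l l / 2" if "l \<in> \<Lambda>" for l using u(2)[OF that] by simp
  then show ?thesis by (rule that)
qed

text \<open>Both facts reduce to a ball that meets every class modulo \<open>\<Lambda>\<close>.\<close>

lemma periodic_continuous:
  fixes p :: "'a \<Rightarrow> real"
  assumes per: "\<And>x l. l \<in> \<Lambda> \<Longrightarrow> p (x + l) = p x" and cont: "continuous_on UNIV p"
  shows periodic_continuous_bounded: "\<exists>B. \<forall>x. \<bar>p x\<bar> \<le> B"
    and periodic_continuous_uniform: "e > 0 \<Longrightarrow> \<exists>d>0. \<forall>x t. norm t < d \<longrightarrow> \<bar>p (x - t) - p x\<bar> < e"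
proof -
  obtain R where R: "R > 0" "\<And>x. \<exists>l\<in>\<Lambda>. norm (x - l) \<le> R"
    using full_lattice_covering[OF \<Lambda>] by metis
  have cont: "continuous_on (cball 0 (R + 1)) p" using cont continuous_on_subset by blast
  have red: "\<exists>y\<in>cball 0 R. \<forall>t. p (x - t) = p (y - t)" for x
  proof -
    obtain l where l: "l \<in> \<Lambda>" "norm (x - l) \<le> R" using R by blast
    have "p (x - t) = p (x - l - t)" for t
      using per[OF l(1), of "x - l - t"] by simp
    then show ?thesis using l by (intro bexI[of _ "x - l"]) auto
  qed
  show "\<exists>B. \<forall>x. \<bar>p x\<bar> \<le> B"
  proof -
    have "bounded (p ` cball 0 (R + 1))"
      using cont by (intro compact_imp_bounded compact_continuous_image) auto
    then obtain B where B: "\<forall>y\<in>cball 0 (R + 1). \<bar>p y\<bar> \<le> B"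
      unfolding bounded_iff by auto
    have "\<bar>p x\<bar> \<le> B" for x
    proof -
      obtain y where "y \<in> cball 0 R" "p (x - 0) = p (y - 0)" using red by blast
      then show ?thesis using B[rule_format, of y] by simp
    qed
    then show ?thesis by blast
  qed
  assume "e > 0"
  have "uniformly_continuous_on (cball 0 (R + 1)) p"
    using cont by (intro compact_uniformly_continuous) auto
  then obtain d where d: "d > 0" "\<And>x y. x \<in> cball 0 (R + 1) \<Longrightarrow> y \<in> cball 0 (R + 1) \<Longrightarrow>
      dist y x < d \<Longrightarrow> dist (p y) (p x) < e"
    using \<open>e > 0\<close> unfolding uniformly_continuous_on_def by metis
  have "\<bar>p (x - t) - p x\<bar> < e" if t: "norm t < min d 1" for x t
  proof -
    obtain y where y: "norm y \<le> R" "\<And>t. p (x - t) = p (y - t)" using red[of x] by auto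
    have "norm (y - t) \<le> R + 1" using norm_triangle_ineq4[of y t] y t by simp
    then have "dist (p (y - t)) (p y) < e" using y t by (intro d(2)) (auto simp: dist_norm norm_minus_commute)
    then show ?thesis using y(2)[of t] y(2)[of 0] by (simp add: dist_real_def)
  qed
  then show "\<exists>d>0. \<forall>x t. norm t < d \<longrightarrow> \<bar>p (x - t) - p x\<bar> < e"
    using d(1) by (intro exI[of _ "min d 1"]) auto
qed

lemma finite_scaled_lattice:
  assumes "m > 0" "bounded K"
  shows "finite {\<mu> \<in> K. real m *\<^sub>R \<mu> \<in> \<Lambda>}"
proof -
  have "finite (\<Lambda> \<inter> (\<lambda>x. real m *\<^sub>R x) ` K)"
    by (rule finite_lattice_bounded[OF N b_int]) (use assms(2) in \<open>simp_all add: bounded_scaling\<close>)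
  moreover have "(\<lambda>x. real m *\<^sub>R x) ` {\<mu> \<in> K. real m *\<^sub>R \<mu> \<in> \<Lambda>} \<subseteq> \<Lambda> \<inter> (\<lambda>x. real m *\<^sub>R x) ` K"
    by auto
  ultimately have "finite ((\<lambda>x. real m *\<^sub>R x) ` {\<mu> \<in> K. real m *\<^sub>R \<mu> \<in> \<Lambda>})"
    by (rule rev_finite_subset)
  moreover have "inj_on (\<lambda>x. real m *\<^sub>R x) {\<mu> \<in> K. real m *\<^sub>R \<mu> \<in> \<Lambda>}"
    by (rule inj_onI) (use assms(1) in simp)
  ultimately show ?thesis by (rule finite_imageD)
qed

lemma bounded_b_ball: "bounded {x. b x x \<le> r}"
proof -
  obtain \<kappa> where \<kappa>: "\<kappa> > 0" "\<And>x. \<kappa> * (norm x)\<^sup>2 \<le> b x x" by (rule b_lower) blast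
  have "norm x \<le> sqrt (\<bar>r\<bar> / \<kappa>)" if "b x x \<le> r" for x
  proof (rule real_le_rsqrt)
    have "\<kappa> * (norm x)\<^sup>2 \<le> \<bar>r\<bar>" using \<kappa>(2)[of x] that by simp
    then show "(norm x)\<^sup>2 \<le> \<bar>r\<bar> / \<kappa>" using \<kappa>(1) by (simp add: field_simps)
  qed
  then show ?thesis unfolding bounded_iff by blast
qed

lemma lattice_minimum:
  obtains \<beta> where "\<beta> > 0" "\<And>l. l \<in> \<Lambda> \<Longrightarrow> l \<noteq> 0 \<Longrightarrow> b l l \<ge> \<beta>"
proof -
  define A where "A = insert 1 ((\<lambda>l. b l l) ` (\<Lambda> \<inter> {x. b x x \<le> 1} - {0}))"
  have fin: "finite A"
    unfolding A_def using finite_lattice_bounded[OF N b_int bounded_b_ball[of 1]] by simp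
  have "Min A > 0" using fin b_pos by (auto simp: A_def)
  moreover have "b l l \<ge> Min A" if "l \<in> \<Lambda>" "l \<noteq> 0" for l
  proof (cases "b l l \<le> 1")
    case True
    then show ?thesis using fin that by (intro Min_le) (auto simp: A_def)
  next
    case False
    moreover have "Min A \<le> 1" using fin by (intro Min_le) (auto simp: A_def)
    ultimately show ?thesis by simp
  qed
  ultimately show ?thesis by (rule that)
qed

end

text \<open>
  The parameter \<open>v\<^sub>0\<close> is the linear part of the quadratic model, from which \<open>F\<close> differs by a
  bounded function, and \<open>\<epsilon>\<close> is a modulus of strong convexity.
\<close>

locale strongly_convex_cocycle = cocycle_data b \<Gamma> N \<Lambda> z
  for b :: "'a::euclidean_space \<Rightarrow> 'a \<Rightarrow> real" and \<Gamma> N \<Lambda> z +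
  fixes F :: "'a \<Rightarrow> real" and \<epsilon> B :: real and v\<^sub>0 :: 'a
  assumes \<epsilon>: "\<epsilon> > 0"
    and v0: "l \<in> \<Lambda> \<Longrightarrow> b v\<^sub>0 l = z l 0 - b l l / 2"
    and F_cocycle: "l \<in> \<Lambda> \<Longrightarrow> F (x + l) = F x + z l x"
    and F_quadratic: "\<bar>F x - (b x x / 2 + b v\<^sub>0 x)\<bar> \<le> B"
    and support: "\<exists>v. \<forall>y. F y \<ge> F x + b v (y - x) + \<epsilon> / 2 * b (y - x) (y - x)"
begin

text \<open>The negative of the convex conjugate, with the dual space identified via \<open>b\<close>.\<close>

definition dual :: "'a \<Rightarrow> real" where
  "dual \<mu> = Inf (range (\<lambda>y. F y - b \<mu> y))"

text \<open>Strong convexity at \<open>x\<close> bounds the loss when the supporting slope \<open>v\<close> is replaced by \<open>\<mu>\<close>.\<close>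

lemma support_shift:
  assumes "\<And>y. F y \<ge> F x + b v (y - x) + \<epsilon> / 2 * b (y - x) (y - x)"
  shows "F y - b \<mu> y \<ge> F x - b \<mu> x - b (\<mu> - v) (\<mu> - v) / (2 * \<epsilon>)"
proof -
  have "b v (y - x) - b \<mu> y = - b (\<mu> - v) (y - x) - b \<mu> x" by (simp add: b_simps)
  then show ?thesis
    using assms[of y] quadratic_absorbs_linear[OF \<epsilon>, of "\<mu> - v" "y - x"] by linarith
qed

lemma dual_le: "dual \<mu> \<le> F y - b \<mu> y"
proof -
  obtain v where v: "\<And>y. F y \<ge> F 0 + b v (y - 0) + \<epsilon> / 2 * b (y - 0) (y - 0)"
    using support[of 0] by blast
  have "bdd_below (range (\<lambda>y. F y - b \<mu> y))"
    using support_shift[OF v, of \<mu>] by (intro bdd_belowI) blast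
  then show ?thesis unfolding dual_def by (intro cInf_lower) auto
qed

lemma dual_ge: "(\<And>y. a \<le> F y - b \<mu> y) \<Longrightarrow> a \<le> dual \<mu>"
  unfolding dual_def by (intro cInf_greatest) auto

text \<open>
  Substituting \<open>y = w + l\<close> in the infimum and using the cocycle rule gives one inequality, and the
  other follows by exchanging the roles of \<open>\<mu>\<close> and \<open>\<mu> + l\<close>.
\<close>

lemma dual_translate:
  assumes l: "l \<in> \<Lambda>"
  shows "dual (\<mu> + l) = dual \<mu> - b \<mu> l + z l 0 - b l l"
proof -
  have ge: "dual (\<mu> + l) \<ge> dual \<mu> - b \<mu> l + z l 0 - b l l" if "l \<in> \<Lambda>" for \<mu> l
  proof (rule dual_ge)
    fix y
    have "F y = F (y - l) + z l 0 + b l (y - l)"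
      using F_cocycle[OF that, of "y - l"] z_affine[OF that, of "y - l"] by simp
    then show "dual \<mu> - b \<mu> l + z l 0 - b l l \<le> F y - b (\<mu> + l) y"
      using dual_le[of \<mu> "y - l"] by (simp add: b_simps)
  qed
  have "- l \<in> \<Lambda>" using \<Lambda>_closed(3)[OF l] .
  moreover have "z (- l) 0 = b l l - z l 0"
    using z_add_0[of "- l" l] \<Lambda>_closed(3)[OF l] l z_0 by (simp add: b_simps)
  ultimately have "dual \<mu> \<ge> dual (\<mu> + l) + b \<mu> l - z l 0 + b l l"
    using ge[of "- l" "\<mu> + l"] by (simp add: b_simps)
  then show ?thesis using ge[OF l, of \<mu>] by simp
qed

text \<open>The value that \<open>dual\<close> takes for the quadratic model, up to a constant.\<close>

definition model :: "'a \<Rightarrow> real" where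
  "model \<mu> = b v\<^sub>0 \<mu> - b \<mu> \<mu> / 2"

lemma model_in_\<Gamma>: "\<mu> \<in> rational \<Longrightarrow> model \<mu> \<in> \<Gamma>"
proof -
  have half: "x / 2 \<in> \<Gamma>" if "x \<in> \<Gamma>" for x using \<Gamma>_divide[OF that, of 2] by simp
  assume \<mu>: "\<mu> \<in> rational"
  then obtain m where m: "m > 0" "real m *\<^sub>R \<mu> \<in> \<Lambda>" by (rule rationalE)
  have "b v\<^sub>0 (real m *\<^sub>R \<mu>) / real m \<in> \<Gamma>"
    using m v0[OF m(2)] by (auto intro!: \<Gamma>_divide \<Gamma>_diff z_\<Gamma> half b_\<Lambda>_in_\<Gamma>)
  then have "b v\<^sub>0 \<mu> \<in> \<Gamma>" using m by (simp add: b_simps)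
  then show ?thesis unfolding model_def using b_rational_in_\<Gamma>[OF \<mu> \<mu>] by (intro \<Gamma>_diff half)
qed

lemma model_translate: "l \<in> \<Lambda> \<Longrightarrow> model (\<mu> + l) = model \<mu> - b \<mu> l + z l 0 - b l l"
  using v0[of l] by (simp add: model_def b_simps b_sym[of l \<mu>] field_simps)

text \<open>
  Affine minorants that come close to \<open>F\<close> at a point \<open>x\<close> of a bounded set have bounded slopes:
  comparing with \<open>F\<close> at \<open>x\<close> and \<open>x + \<mu>\<close>, the quadratic growth of \<open>F\<close> forces \<open>b \<mu> \<mu> / 2\<close> to grow at most linearly in \<open>\<mu>\<close>.
\<close>

lemma bounded_close_slopes:
  assumes "bounded K"
  shows "bounded {\<mu>. \<exists>x\<in>K. b \<mu> x + dual \<mu> \<ge> F x - \<delta>}"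
proof -
  obtain r where r: "\<And>x. x \<in> K \<Longrightarrow> norm x \<le> r" using assms bounded_iff by metis
  obtain C where C: "C > 0" "\<And>x y. \<bar>b x y\<bar> \<le> C * norm x * norm y" by (rule b_upper) blast
  obtain \<kappa> where \<kappa>: "\<kappa> > 0" "\<And>x. \<kappa> * (norm x)\<^sup>2 \<le> b x x" by (rule b_lower) blast
  define A where "A = 2 * C * (\<bar>r\<bar> + norm v\<^sub>0)"
  define D where "D = \<bar>4 * B + 2 * \<delta>\<bar>"
  have AD: "A \<ge> 0" "D \<ge> 0" using C by (auto simp: A_def D_def)
  have "norm \<mu> \<le> (A + D) / \<kappa> + 1" if "x \<in> K" and close: "b \<mu> x + dual \<mu> \<ge> F x - \<delta>" for x \<mu>
  proof -
    have "F x - \<delta> \<le> F (x + \<mu>) - b \<mu> \<mu>"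
      using close dual_le[of \<mu> "x + \<mu>"] by (simp add: b_simps)
    then have "b \<mu> \<mu> \<le> 2 * b (x + v\<^sub>0) \<mu> + (4 * B + 2 * \<delta>)"
    proof -
      have "b (x + \<mu>) (x + \<mu>) / 2 + b v\<^sub>0 (x + \<mu>) - (b x x / 2 + b v\<^sub>0 x) = b (x + v\<^sub>0) \<mu> + b \<mu> \<mu> / 2"
        by (simp add: b_simps b_sym[of \<mu> x] field_simps)
      then show ?thesis
        using \<open>F x - \<delta> \<le> F (x + \<mu>) - b \<mu> \<mu>\<close> F_quadratic[of x] F_quadratic[of "x + \<mu>"] by linarith
    qed
    also have "b (x + v\<^sub>0) \<mu> \<le> C * norm (x + v\<^sub>0) * norm \<mu>" using C(2)[of "x + v\<^sub>0" \<mu>] by linarith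
    also have "C * norm (x + v\<^sub>0) * norm \<mu> \<le> C * (\<bar>r\<bar> + norm v\<^sub>0) * norm \<mu>"
      using C(1) norm_triangle_ineq[of x "v\<^sub>0"] r[OF \<open>x \<in> K\<close>]
      by (intro mult_right_mono mult_left_mono) auto
    finally have "b \<mu> \<mu> \<le> A * norm \<mu> + D" by (simp add: A_def D_def)
    then have le: "\<kappa> * (norm \<mu>)\<^sup>2 \<le> A * norm \<mu> + D" using \<kappa>(2)[of \<mu>] by simp
    show ?thesis
    proof (cases "norm \<mu> \<le> 1")
      case True
      then show ?thesis using AD \<kappa>(1) by (smt (verit) divide_nonneg_pos)
    next
      case False
      then have "D \<le> D * norm \<mu>" using AD mult_left_mono[of 1 "norm \<mu>" D] by simp
      then have "norm \<mu> * (\<kappa> * norm \<mu>) \<le> norm \<mu> * (A + D)"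
        using le by (simp add: power2_eq_square algebra_simps)
      then have "\<kappa> * norm \<mu> \<le> A + D" using False by (subst (asm) mult_le_cancel_left_pos) auto
      then have "norm \<mu> \<le> (A + D) / \<kappa>" using \<kappa>(1) by (simp add: field_simps)
      then show ?thesis by simp
    qed
  qed
  then show ?thesis unfolding bounded_iff by blast
qed

text \<open>
  The maximum runs over the slopes in a refinement \<open>\<Lambda> / m\<close> of the lattice. Its constants are those
  of \<open>dual\<close>, rounded into \<open>\<Gamma>\<close>; since \<open>dual - model\<close> is periodic and \<open>model\<close> has values in \<open>\<Gamma>\<close>, it is
  this difference that is rounded, which preserves equivariance. On a cell, \<open>h\<close> is affine and
  \<open>\<delta>\<close>-close to the strongly convex \<open>F\<close>, so differences \<open>x\<close> of points of the cell satisfy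
  \<open>b x x \<le> 16 \<delta> / \<epsilon>\<close>; for small \<open>\<delta>\<close> the cell is too small to meet its translates.
\<close>

lemma approximating_family:
  assumes "\<eta> > 0"
  obtains I c h where "periodic_family b I c h \<Gamma> N \<Lambda> z" "\<And>x. \<bar>h x - F x\<bar> \<le> \<eta>"
proof -
  obtain \<beta> where \<beta>: "\<beta> > 0" "\<And>l. l \<in> \<Lambda> \<Longrightarrow> l \<noteq> 0 \<Longrightarrow> b l l \<ge> \<beta>" by (rule lattice_minimum) blast
  define \<delta> where "\<delta> = min \<eta> (\<epsilon> * \<beta> / 32)"
  have \<delta>: "\<delta> > 0" "\<delta> \<le> \<eta>" "16 * \<delta> \<le> \<epsilon> * \<beta> / 2" using assms \<epsilon> \<beta>(1) by (auto simp: \<delta>_def)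
  obtain C where C: "C > 0" "\<And>x y. \<bar>b x y\<bar> \<le> C * norm x * norm y" by (rule b_upper) blast
  obtain R where R: "R > 0" "\<And>m x. m > 0 \<Longrightarrow> \<exists>y. real m *\<^sub>R y \<in> \<Lambda> \<and> norm (x - y) \<le> R / real m"
    using scaled_lattice_covering by metis
  \<comment> \<open>With this mesh the loss \<open>b (\<mu> - v) (\<mu> - v) / (2 \<epsilon>)\<close> of \<open>support_shift\<close> is at most \<open>\<delta> / 2\<close>; the
    other half of \<open>\<delta>\<close> is for the rounding of the constants.\<close>
  obtain m :: nat where m: "max 1 (C * R\<^sup>2 / (\<epsilon> * \<delta>)) < real m" using reals_Archimedean2 by blast
  then have "m > 0" by (intro gr0I) auto
  define I where "I = {\<mu>. real m *\<^sub>R \<mu> \<in> \<Lambda>}"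
  have I_rational: "\<mu> \<in> rational" if "\<mu> \<in> I" for \<mu> using that \<open>m > 0\<close> by (auto simp: I_def rational_def)
  obtain \<rho> where \<rho>: "\<And>s. \<rho> s \<in> \<Gamma>" "\<And>s. \<bar>\<rho> s - s\<bar> \<le> \<delta> / 2"
    using \<Gamma>_dense[of "\<delta> / 2"] \<delta>(1) by (metis half_gt_zero)
  define c where "c \<mu> = model \<mu> + \<rho> (dual \<mu> - model \<mu>)" for \<mu>
  have c: "\<bar>c \<mu> - dual \<mu>\<bar> \<le> \<delta> / 2" for \<mu>
    using \<rho>(2)[of "dual \<mu> - model \<mu>"] by (simp add: c_def algebra_simps)
  have below: "b \<mu> x + c \<mu> \<le> F x + \<delta> / 2" for \<mu> x using c[of \<mu>] dual_le[of \<mu> x] by linarith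
  have close: "\<exists>\<mu>\<in>I. b \<mu> x + c \<mu> \<ge> F x - \<delta>" for x
  proof -
    obtain v where v: "\<And>y. F y \<ge> F x + b v (y - x) + \<epsilon> / 2 * b (y - x) (y - x)" using support by blast
    obtain \<mu> where \<mu>: "\<mu> \<in> I" "norm (v - \<mu>) \<le> R / real m"
      using R(2)[OF \<open>m > 0\<close>, of v] by (auto simp: I_def)
    have "b (\<mu> - v) (\<mu> - v) \<le> C * norm (\<mu> - v) * norm (\<mu> - v)" using C(2)[of "\<mu> - v" "\<mu> - v"] by linarith
    also have "\<dots> \<le> C * (R / real m) * (R / real m)"
      using \<mu>(2) C(1) R(1) by (intro mult_mono) (auto simp: norm_minus_commute)
    also have "\<dots> = C * R\<^sup>2 / real m / real m" by (simp add: power2_eq_square)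
    also have "\<dots> \<le> C * R\<^sup>2 / real m / 1"
      using m C(1) R(1) by (intro divide_left_mono) auto
    also have "\<dots> \<le> \<epsilon> * \<delta>" using m \<epsilon> \<delta>(1) \<open>m > 0\<close> by (simp add: field_simps)
    finally have "b (\<mu> - v) (\<mu> - v) / (2 * \<epsilon>) \<le> \<delta> / 2" using \<epsilon> by (simp add: field_simps)
    then have "F x - b \<mu> x - \<delta> / 2 \<le> F y - b \<mu> y" for y using support_shift[OF v, of \<mu> y] by simp
    then have "F x - b \<mu> x - \<delta> / 2 \<le> dual \<mu>" by (rule dual_ge)
    then have "F x - \<delta> \<le> b \<mu> x + c \<mu>" using c[of \<mu>] by linarith
    then show ?thesis using \<mu>(1) by blast
  qed
  have fin: "finite {\<mu>\<in>I. \<exists>x\<in>K. b \<mu> x + c \<mu> \<ge> F x - \<delta>}" if "bounded K" for K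
  proof -
    have "finite {\<mu> \<in> {\<mu>. \<exists>x\<in>K. b \<mu> x + dual \<mu> \<ge> F x - 2 * \<delta>}. real m *\<^sub>R \<mu> \<in> \<Lambda>}"
      by (intro finite_scaled_lattice \<open>m > 0\<close> bounded_close_slopes that)
    moreover have "F x - 2 * \<delta> \<le> b \<mu> x + dual \<mu>" if "b \<mu> x + c \<mu> \<ge> F x - \<delta>" for \<mu> x
      using c[of \<mu>] that \<delta>(1) by linarith
    ultimately show ?thesis by (elim rev_finite_subset) (auto simp: I_def)
  qed
  have "\<exists>\<mu>\<in>I. \<forall>\<nu>\<in>I. b \<nu> x + c \<nu> \<le> b \<mu> x + c \<mu>" for x
  proof -
    define S where "S = {\<mu>\<in>I. b \<mu> x + c \<mu> \<ge> F x - \<delta>}"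
    have S: "finite S" "S \<noteq> {}" using fin[of "{x}"] close[of x] by (auto simp: S_def)
    then have "Max ((\<lambda>\<mu>. b \<mu> x + c \<mu>) ` S) \<in> (\<lambda>\<mu>. b \<mu> x + c \<mu>) ` S" by (intro Max_in) auto
    then obtain \<mu> where \<mu>: "\<mu> \<in> S" "Max ((\<lambda>\<mu>. b \<mu> x + c \<mu>) ` S) = b \<mu> x + c \<mu>" by blast
    have le: "b \<nu> x + c \<nu> \<le> b \<mu> x + c \<mu>" if "\<nu> \<in> S" for \<nu>
      using S(1) that unfolding \<mu>(2)[symmetric] by (intro Max_ge) auto
    have "b \<nu> x + c \<nu> \<le> b \<mu> x + c \<mu>" if "\<nu> \<in> I" for \<nu>
      using le[of \<nu>] \<mu>(1) that by (cases "\<nu> \<in> S") (auto simp: S_def)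
    then show ?thesis using \<mu>(1) by (auto simp: S_def)
  qed
  then obtain M where M: "\<And>x. M x \<in> I" "\<And>x \<nu>. \<nu> \<in> I \<Longrightarrow> b \<nu> x + c \<nu> \<le> b (M x) x + c (M x)" by metis
  define h where "h x = b (M x) x + c (M x)" for x
  have h_upper: "h x \<le> F x + \<delta> / 2" for x using below by (simp add: h_def)
  have h_lower: "h x \<ge> F x - \<delta>" for x
    using close[of x] M(2)[of _ x] by (force simp: h_def)
  \<comment> \<open>Compare the values at the midpoint \<open>w\<close>: \<open>h\<close> is affine on the cell, while strong convexity
    pushes \<open>F w\<close> below the mean of \<open>F x\<close> and \<open>F y\<close>.\<close>
  have diam: "b (y - x) (y - x) \<le> \<beta> / 2"
    if "\<mu> \<in> I" and x: "h x = b \<mu> x + c \<mu>" and y: "h y = b \<mu> y + c \<mu>" for \<mu> x y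
  proof -
    define w where "w = (1 / 2) *\<^sub>R (x + y)"
    have wx: "x - w = - (1 / 2) *\<^sub>R (y - x)" and wy: "y - w = (1 / 2) *\<^sub>R (y - x)"
      by (simp_all add: w_def algebra_simps flip: scaleR_add_left)
    obtain v where v: "\<And>y. F y \<ge> F w + b v (y - w) + \<epsilon> / 2 * b (y - w) (y - w)" using support by blast
    have e: "b v (x - w) = - b v (y - w)" "b (x - w) (x - w) = b (y - x) (y - x) / 4"
        "b (y - w) (y - w) = b (y - x) (y - x) / 4"
      unfolding wx wy by (simp_all only: bilinear_lmul[OF bil] bilinear_rmul[OF bil]) simp_all
    have "\<epsilon> / 2 * (b (y - x) (y - x) / 4) = \<epsilon> / 4 * b (y - x) (y - x) / 2" by simp
    then have sum: "2 * F w + \<epsilon> / 4 * b (y - x) (y - x) \<le> F x + F y"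
      using v[of x] v[of y] unfolding e by linarith
    have "h w \<ge> b \<mu> w + c \<mu>" using M(2)[OF that(1), of w] by (simp add: h_def)
    moreover have "2 * (b \<mu> w + c \<mu>) = h x + h y" using x y by (simp add: w_def b_simps)
    ultimately have "F x + F y \<le> 2 * F w + 3 * \<delta>"
      using h_upper[of w] h_lower[of x] h_lower[of y] by (simp add: field_simps)
    with sum have "\<epsilon> / 4 * b (y - x) (y - x) \<le> 4 * \<delta>" using \<delta>(1) by argo
    then have "\<epsilon> * b (y - x) (y - x) \<le> \<epsilon> * (\<beta> / 2)" using \<delta>(3) by (simp add: field_simps)
    then show ?thesis using \<epsilon> by (simp add: mult_le_cancel_left_pos)
  qed
  have "periodic_family b I c h \<Gamma> N \<Lambda> z"
  proof
    fix \<mu> x assume "\<mu> \<in> I"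
    then show "b \<mu> x + c \<mu> \<le> h x" by (simp add: h_def M)
  next
    fix x show "\<exists>\<mu>\<in>I. h x = b \<mu> x + c \<mu>" using M(1) h_def by blast
  next
    fix K :: "'a set" assume K: "bounded K"
    have "b \<mu> x + c \<mu> \<ge> F x - \<delta>" if "h x = b \<mu> x + c \<mu>" for \<mu> x
      using h_lower[of x] that by simp
    then have "{\<mu>\<in>I. \<exists>x\<in>K. h x = b \<mu> x + c \<mu>} \<subseteq> {\<mu>\<in>I. \<exists>x\<in>K. b \<mu> x + c \<mu> \<ge> F x - \<delta>}" by blast
    then show "finite {\<mu>\<in>I. \<exists>x\<in>K. h x = b \<mu> x + c \<mu>}" using fin[OF K] finite_subset by blast
  next
    fix \<mu> assume \<mu>: "\<mu> \<in> I"
    show "bounded {x. h x = b \<mu> x + c \<mu>}"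
    proof (cases "{x. h x = b \<mu> x + c \<mu>} = {}")
      case False
      then obtain x where x: "h x = b \<mu> x + c \<mu>" by blast
      have "{x. h x = b \<mu> x + c \<mu>} \<subseteq> (+) x ` {y. b y y \<le> \<beta> / 2}"
      proof
        fix y assume "y \<in> {x. h x = b \<mu> x + c \<mu>}"
        then have "b (y - x) (y - x) \<le> \<beta> / 2" using diam[OF \<mu> x, of y] by simp
        then show "y \<in> (+) x ` {y. b y y \<le> \<beta> / 2}" by (intro image_eqI[of _ _ "y - x"]) auto
      qed
      then show ?thesis using bounded_translation[OF bounded_b_ball] bounded_subset by blast
    qed simp
  next
    fix \<mu> assume \<mu>: "\<mu> \<in> I"
    then show "\<mu> \<in> rational" by (rule I_rational)
    then show "c \<mu> \<in> \<Gamma>" unfolding c_def by (intro \<Gamma>_add model_in_\<Gamma> \<rho>(1))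
    fix l assume l: "l \<in> \<Lambda>"
    have "dual (\<mu> + l) - model (\<mu> + l) = dual \<mu> - model \<mu>"
      using dual_translate[OF l] model_translate[OF l] by simp
    then have "c (\<mu> + l) = model (\<mu> + l) + \<rho> (dual \<mu> - model \<mu>)" by (simp only: c_def)
    then have "c (\<mu> + l) = c \<mu> - b \<mu> l + z l 0 - b l l"
      using model_translate[OF l, of \<mu>] by (simp add: c_def)
    moreover have "\<mu> + l \<in> I"
      using \<mu> \<Lambda>_closed(2)[OF _ \<Lambda>_mult_nat[OF l, of m]] by (simp add: I_def scaleR_add_right)
    ultimately show "\<mu> + l \<in> I \<and> c (\<mu> + l) = c \<mu> - b \<mu> l + z l 0 - b l l" by simp
    fix x assume x: "h x = b \<mu> x + c \<mu>" "h (x + l) = b \<mu> (x + l) + c \<mu>"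
    show "l = 0"
    proof (rule ccontr)
      assume "l \<noteq> 0"
      then show False using diam[OF \<mu> x] \<beta>(2)[OF l] \<beta>(1) by simp
    qed
  qed
  moreover have "\<bar>h x - F x\<bar> \<le> \<eta>" for x using h_upper[of x] h_lower[of x] \<delta> by linarith
  ultimately show ?thesis by (rule that)
qed

end
section \<open>The approximation theorem\<close>

context cocycle_data
begin

lemma quadratic_cocycle:
  assumes "\<And>l. l \<in> \<Lambda> \<Longrightarrow> b v l = z l 0 - b l l / 2" "l \<in> \<Lambda>"
  shows "b (x + l) (x + l) / 2 + b v (x + l) = b x x / 2 + b v x + z l x"
proof -
  have "b (x + l) (x + l) / 2 + b v (x + l) = b x x / 2 + b v x + (b l l / 2 + b v l + b l x)"
    by (simp add: b_simps b_sym[of x l] field_simps)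
  also have "b l l / 2 + b v l + b l x = z l x"
    using assms(1)[OF assms(2)] z_affine[OF assms(2), of x] by linarith
  finally show ?thesis .
qed

lemma quadratic_continuous: "continuous_on UNIV (\<lambda>x. b x x / 2 + b v x)"
proof -
  have "bounded_bilinear b" using bil by (simp add: bilinear_conv_bounded_bilinear)
  then have "continuous_on UNIV (\<lambda>x. b x x)" "continuous_on UNIV (\<lambda>x. b v x)"
    by (auto intro: bounded_bilinear.continuous_on continuous_on_id continuous_on_const)
  then show ?thesis by (intro continuous_on_add continuous_on_divide continuous_on_const) auto
qed

text \<open>
  Moving \<open>f\<close> slightly towards the quadratic model makes it strongly convex. The error is
  uniformly small because \<open>f\<close> minus the model is continuous and periodic, hence bounded.
\<close>

lemma strongly_convex_approximation:
  assumes f: "convex_on UNIV f" and coc: "cocycle_rule \<Lambda> z f"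
    and v: "\<And>l. l \<in> \<Lambda> \<Longrightarrow> b v l = z l 0 - b l l / 2" and "\<eta> > 0"
  obtains F \<epsilon> B where "strongly_convex_cocycle b \<Gamma> N \<Lambda> z F \<epsilon> B v" "\<And>x. \<bar>F x - f x\<bar> \<le> \<eta>"
proof -
  define q where "q x = b x x / 2 + b v x" for x
  define p where "p x = f x - q x" for x
  have p_per: "p (x + l) = p x" if "l \<in> \<Lambda>" for x l
  proof -
    have "f (x + l) = f x + z l x" using coc that by (simp add: cocycle_rule_def)
    then show ?thesis using quadratic_cocycle[OF v that, of x] by (simp add: p_def q_def)
  qed
  have "continuous_on UNIV q" unfolding q_def by (rule quadratic_continuous)
  then have "continuous_on UNIV p"
    unfolding p_def by (intro continuous_on_diff convex_on_continuous[OF open_UNIV f])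
  then obtain B where B: "\<And>x. \<bar>p x\<bar> \<le> B"
    using periodic_continuous_bounded[of p] p_per by blast
  have "B \<ge> 0" using B[of 0] by linarith
  define \<epsilon> where "\<epsilon> = min (1 / 2) (\<eta> / (B + 1))"
  have \<epsilon>: "\<epsilon> > 0" "\<epsilon> < 1" using \<open>\<eta> > 0\<close> \<open>B \<ge> 0\<close> by (auto simp: \<epsilon>_def)
  have "\<epsilon> * (B + 1) \<le> \<eta>"
  proof -
    have "\<epsilon> * (B + 1) \<le> \<eta> / (B + 1) * (B + 1)"
      using \<open>B \<ge> 0\<close> by (intro mult_right_mono) (auto simp: \<epsilon>_def)
    then show ?thesis using \<open>B \<ge> 0\<close> by simp
  qed
  define F where "F x = (1 - \<epsilon>) * f x + \<epsilon> * q x" for x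
  have F_q: "F x - q x = (1 - \<epsilon>) * p x" and F_f: "F x - f x = - (\<epsilon> * p x)" for x
    by (simp_all add: F_def p_def algebra_simps)
  have "strongly_convex_cocycle b \<Gamma> N \<Lambda> z F \<epsilon> B v"
  proof
    show "\<epsilon> > 0" by (rule \<epsilon>(1))
    show "b v l = z l 0 - b l l / 2" if "l \<in> \<Lambda>" for l by (rule v[OF that])
    show "F (x + l) = F x + z l x" if "l \<in> \<Lambda>" for x l
    proof -
      have "F (x + l) = f (x + l) - \<epsilon> * p x" using F_f[of "x + l"] p_per[OF that, of x] by simp
      also have "f (x + l) = f x + z l x" using coc that by (simp add: cocycle_rule_def)
      finally show ?thesis using F_f[of x] by simp
    qed
    show "\<bar>F x - (b x x / 2 + b v x)\<bar> \<le> B" for x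
    proof -
      have "\<bar>F x - q x\<bar> \<le> \<bar>p x\<bar>" using F_q[of x] \<epsilon> by (simp add: abs_mult mult_left_le_one_le)
      then show ?thesis using B[of x] by (simp add: q_def)
    qed
    fix x
    obtain w where w: "\<And>y. f x + w \<bullet> (y - x) \<le> f y" by (rule convex_on_UNIV_subgradient[OF f, of x]) blast
    obtain u where u: "\<And>y. b u y = w \<bullet> y" using b_represents by metis
    have "F y \<ge> F x + b ((1 - \<epsilon>) *\<^sub>R u + \<epsilon> *\<^sub>R (x + v)) (y - x) + \<epsilon> / 2 * b (y - x) (y - x)" for y
    proof -
      have "(1 - \<epsilon>) * (f x + b u (y - x)) \<le> (1 - \<epsilon>) * f y"
        using w[of y] \<epsilon> by (intro mult_left_mono) (simp_all add: u)
      moreover have "q y = q x + b (x + v) (y - x) + b (y - x) (y - x) / 2"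
        by (simp add: q_def b_simps b_sym[of y x] field_simps)
      then have "\<epsilon> * q y = \<epsilon> * q x + \<epsilon> * b (x + v) (y - x) + \<epsilon> / 2 * b (y - x) (y - x)"
        by (simp add: distrib_left)
      moreover have "b ((1 - \<epsilon>) *\<^sub>R u + \<epsilon> *\<^sub>R (x + v)) (y - x) = (1 - \<epsilon>) * b u (y - x) + \<epsilon> * b (x + v) (y - x)"
        by (simp only: bilinear_ladd[OF bil] bilinear_lmul[OF bil] real_scaleR_def)
      ultimately show ?thesis unfolding F_def distrib_left by linarith
    qed
    then show "\<exists>v. \<forall>y. F y \<ge> F x + b v (y - x) + \<epsilon> / 2 * b (y - x) (y - x)" by blast
  qed
  moreover have "\<bar>F x - f x\<bar> \<le> \<eta>" for x
  proof -
    have "\<bar>F x - f x\<bar> = \<epsilon> * \<bar>p x\<bar>" using \<epsilon> by (simp add: F_f abs_mult)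
    also have "\<dots> \<le> \<epsilon> * (B + 1)" using B[of x] \<epsilon> by (intro mult_left_mono) auto
    finally show ?thesis using \<open>\<epsilon> * (B + 1) \<le> \<eta>\<close> by simp
  qed
  ultimately show ?thesis by (rule that)
qed

text \<open>
  A translation by \<open>t\<close> with the compensating linear term changes the quadratic model only by a
  constant, so for small \<open>t\<close> it changes \<open>f\<close> little, uniformly on the whole space.
\<close>

lemma translate_close:
  assumes f: "convex_on UNIV f" and coc: "cocycle_rule \<Lambda> z f" and "\<eta> > 0"
  obtains d where "d > 0" "\<And>t x. norm t < d \<Longrightarrow> \<bar>f (x - t) + b t x - f x\<bar> \<le> \<eta>"
proof -
  obtain v where v: "\<And>l. l \<in> \<Lambda> \<Longrightarrow> b v l = z l 0 - b l l / 2" using linear_part by metis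
  define q where "q x = b x x / 2 + b v x" for x
  define p where "p x = f x - q x" for x
  have p_per: "p (x + l) = p x" if "l \<in> \<Lambda>" for x l
  proof -
    have "f (x + l) = f x + z l x" using coc that by (simp add: cocycle_rule_def)
    then show ?thesis using quadratic_cocycle[OF v that, of x] by (simp add: p_def q_def)
  qed
  have q: "continuous_on UNIV q" unfolding q_def by (rule quadratic_continuous)
  then have "continuous_on UNIV p"
    unfolding p_def by (intro continuous_on_diff convex_on_continuous[OF open_UNIV f])
  then obtain d where d: "d > 0" "\<And>x t. norm t < d \<Longrightarrow> \<bar>p (x - t) - p x\<bar> < \<eta> / 2"
    using periodic_continuous_uniform[of p "\<eta> / 2"] p_per \<open>\<eta> > 0\<close> by (metis half_gt_zero)
  have "isCont q 0" using q by (simp add: continuous_on_eq_continuous_at)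
  then obtain d' where d': "d' > 0" "\<And>t. norm t < d' \<Longrightarrow> \<bar>q t - q 0\<bar> < \<eta> / 2"
    using \<open>\<eta> > 0\<close> unfolding continuous_at_eps_delta
    by (metis half_gt_zero dist_norm diff_zero real_norm_def)
  have "\<bar>f (x - t) + b t x - f x\<bar> \<le> \<eta>" if "norm t < min d d'" for t x
  proof -
    have "f (x - t) + b t x - f x = (p (x - t) - p x) + (q (- t) - q 0)"
      by (simp add: p_def q_def b_simps b_sym[of x t] field_simps)
    moreover have "norm (- t) < d'" "norm t < d" using that by auto
    ultimately show ?thesis using d(2)[of t x] d'(2)[of "- t"] by linarith
  qed
  then show ?thesis using d(1) d'(1) by (intro that[of "min d d'"]) auto
qed

text \<open>The error \<open>\<eta>\<close> is shared by strong convexification, affine approximation and translation.\<close>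

lemma transversal_approximation:
  assumes f: "convex_on UNIV f" and coc: "cocycle_rule \<Lambda> z f" and "\<eta> > 0"
    and \<Sigma>: "finite \<Sigma>" "\<And>\<sigma>. \<sigma> \<in> \<Sigma> \<Longrightarrow> polytope \<sigma>"
      "\<And>\<sigma> F. \<sigma> \<in> \<Sigma> \<Longrightarrow> F face_of \<sigma> \<Longrightarrow> F \<noteq> {} \<Longrightarrow> F \<in> \<Sigma>"
  shows "\<exists>h \<C>. (\<forall>x. \<bar>h x - f x\<bar> \<le> \<eta>) \<and> cocycle_rule \<Lambda> z h \<and>
    piecewise_RG_linear N \<rat> \<Gamma> h \<and> RG_polytopal_decomposition N \<int> \<Gamma> \<C> \<and>
    strictly_convex_wrt \<C> h \<and> periodic_complex \<Lambda> \<C> \<and> transversal_to \<Sigma> \<C>"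
proof -
  have \<eta>: "\<eta> / 3 > 0" using \<open>\<eta> > 0\<close> by simp
  obtain v where v: "\<And>l. l \<in> \<Lambda> \<Longrightarrow> b v l = z l 0 - b l l / 2" using linear_part by metis
  obtain F \<epsilon> B where F: "strongly_convex_cocycle b \<Gamma> N \<Lambda> z F \<epsilon> B v" "\<And>x. \<bar>F x - f x\<bar> \<le> \<eta> / 3"
    using strongly_convex_approximation[OF f coc v \<eta>] by metis
  obtain I c h where h: "periodic_family b I c h \<Gamma> N \<Lambda> z" "\<And>x. \<bar>h x - F x\<bar> \<le> \<eta> / 3"
    using strongly_convex_cocycle.approximating_family[OF F(1) \<eta>] by metis
  interpret periodic_family b I c h \<Gamma> N \<Lambda> z by (rule h(1))
  obtain d where d: "d > 0" "\<And>t x. norm t < d \<Longrightarrow> \<bar>f (x - t) + b t x - f x\<bar> \<le> \<eta> / 3"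
    using translate_close[OF f coc \<eta>] by metis
  have convex_cells: "convex P" if "P \<in> cells" for P
    using that convex_cell by (auto elim: cellsE)
  have "\<exists>t\<in>rational. norm t < d \<and> transversal_to \<Sigma> ((`) ((+) t) ` cells)"
    by (rule generic_translate_transversal)
      (fact \<Sigma> convex_cells face_of_cells finite_cells_meeting rational_dense d(1))+
  then obtain t where t: "t \<in> rational" "norm t < d" "transversal_to \<Sigma> ((`) ((+) t) ` cells)"
    by blast
  define I' where "I' = (+) t ` I"
  define c' where "c' = (\<lambda>\<mu>. c (\<mu> - t) - b (\<mu> - t) t)"
  define h' where "h' = (\<lambda>x. h (x - t) + b t x)"
  interpret T: periodic_family b I' c' h' \<Gamma> N \<Lambda> z
    unfolding I'_def c'_def h'_def by (rule translate(1)[OF t(1)])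
  have "T.cells = (`) ((+) t) ` cells"
    unfolding I'_def c'_def h'_def by (rule translate(2)[OF t(1)])
  then have "transversal_to \<Sigma> T.cells" using t(3) by simp
  moreover have "\<bar>h' x - f x\<bar> \<le> \<eta>" for x
    using d(2)[OF t(2), of x] h(2)[of "x - t"] F(2)[of "x - t"] unfolding h'_def by linarith
  ultimately show ?thesis
    using T.cocycle_rule_h T.piecewise_RG_linear_h T.RG_polytopal_decomposition_cells
      T.strictly_convex_h T.periodic_cells by blast
qed

end

theorem proposition3p8:
  fixes \<Gamma> :: "real set"
    and N \<Lambda> :: "'a::euclidean_space set"
    and b :: "'a \<Rightarrow> 'a \<Rightarrow> real"
    and z :: "'a \<Rightarrow> 'a \<Rightarrow> real"
    and \<Sigma> :: "'a set set"
    and f :: "'a \<Rightarrow> real"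
  assumes "divisible_subgroup \<Gamma>" and "\<Gamma> \<noteq> {0}"
    and "full_lattice N"
    and "full_lattice \<Lambda>"
    and "pos_def_inner_product b"
    and "\<And>l x. l \<in> \<Lambda> \<Longrightarrow> x \<in> N \<Longrightarrow> b l x \<in> \<int>"
    and "\<And>l m w. l \<in> \<Lambda> \<Longrightarrow> m \<in> \<Lambda> \<Longrightarrow> z (l + m) w = z l (w + m) + z m w"
    and "\<And>l w. l \<in> \<Lambda> \<Longrightarrow> z l w = z l 0 + b l w"
    and "\<And>l. l \<in> \<Lambda> \<Longrightarrow> z l 0 \<in> \<Gamma>"
    and "finite \<Sigma>"
    and "\<And>\<sigma>. \<sigma> \<in> \<Sigma> \<Longrightarrow> polytope \<sigma>"
    and "\<And>\<sigma> F. \<sigma> \<in> \<Sigma> \<Longrightarrow> F face_of \<sigma> \<Longrightarrow> F \<noteq> {} \<Longrightarrow> F \<in> \<Sigma>"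
    and "convex_on UNIV f"
    and "cocycle_rule \<Lambda> z f"
  shows "\<exists>(fk :: nat \<Rightarrow> 'a \<Rightarrow> real) (\<C> :: nat \<Rightarrow> 'a set set).
           uniform_limit UNIV fk f sequentially \<and>
           (\<forall>k. cocycle_rule \<Lambda> z (fk k) \<and>
                piecewise_RG_linear N \<rat> \<Gamma> (fk k) \<and>
                RG_polytopal_decomposition N \<int> \<Gamma> (\<C> k) \<and>
                strictly_convex_wrt (\<C> k) (fk k) \<and>
                periodic_complex \<Lambda> (\<C> k) \<and>
                transversal_to \<Sigma> (\<C> k))"
proof -
  interpret cocycle_data b \<Gamma> N \<Lambda> z
    by unfold_locales (fact assms)+
  have "\<exists>h \<C>. (\<forall>x. \<bar>h x - f x\<bar> \<le> 1 / real (Suc k)) \<and> cocycle_rule \<Lambda> z h \<and>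
      piecewise_RG_linear N \<rat> \<Gamma> h \<and> RG_polytopal_decomposition N \<int> \<Gamma> \<C> \<and>
      strictly_convex_wrt \<C> h \<and> periodic_complex \<Lambda> \<C> \<and> transversal_to \<Sigma> \<C>" for k
    by (rule transversal_approximation) (fact assms | simp)+
  then obtain fk :: "nat \<Rightarrow> 'a \<Rightarrow> real" and \<C> :: "nat \<Rightarrow> 'a set set" where close: "\<And>k x. \<bar>fk k x - f x\<bar> \<le> 1 / real (Suc k)"
    and props: "\<And>k. cocycle_rule \<Lambda> z (fk k) \<and>
      piecewise_RG_linear N \<rat> \<Gamma> (fk k) \<and> RG_polytopal_decomposition N \<int> \<Gamma> (\<C> k) \<and>
      strictly_convex_wrt (\<C> k) (fk k) \<and> periodic_complex \<Lambda> (\<C> k) \<and> transversal_to \<Sigma> (\<C> k)"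
    by metis
  have "uniform_limit UNIV fk f sequentially"
    unfolding uniform_limit_iff
  proof (intro allI impI)
    fix e :: real assume "e > 0"
    then have "\<forall>\<^sub>F k in sequentially. 1 / real (Suc k) < e"
      using order_tendstoD(2)[OF LIMSEQ_inverse_real_of_nat] by (simp add: inverse_eq_divide)
    then show "\<forall>\<^sub>F k in sequentially. \<forall>x\<in>UNIV. dist (fk k x) (f x) < e"
      by eventually_elim (use close in \<open>auto simp: dist_real_def intro: le_less_trans\<close>)
  qed
  then show ?thesis using props by blast
qed

end
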